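(* Let $\lambda>0$, $0<\alpha\le1$, $c>0$, and let $\{X_i\}_{i\ge1}$ be i.i.d. positive random variables with finite mean and finite variance, independent of $\{\hat N_\alpha(t)\}_{t\ge0}$, whose common distribution function $F_{X_1}$ is subexponential. For initial capital $z>0$ consider the risk process $$\hat R_\alpha(t)=z+ct-\sum_{i=1}^{\hat N_\alpha(t)}X_i,\qquad t\ge0,$$ its ruin time $T=\inf\{t>0:\hat R_\alpha(t)<0\}$ (with $T=\infty$ if $\hat R_\alpha(t)\ge0$ for all $t$), and the finite-time ruin probability $\hat\psi_z(t)=\Pr\{T\le t\}$ for $0<t<\infty$. Then, for each fixed $t\in(0,\infty)$, $$\hat\psi_z(t)\sim\lambda^2t^{2\alpha}E_{\alpha,2\alpha+1}(-2\lambda t^\alpha)\,\bar F_{X_1}(z)\qquad\text{as }z\to\infty,$$ where $\bar F_{X_1}(z)=\Pr\{X_1>z\}$ and $\sim$ means that the ratio of the two sides tends to $1$.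
   Context: Three-parameter Mittag-Leffler function: $E_{\alpha,\beta}^{\gamma}(x)=\frac{1}{\Gamma(\gamma)}\sum_{j=0}^\infty\frac{\Gamma(j+\gamma)x^j}{j!\,\Gamma(j\alpha+\beta)}$ for $\alpha,\beta,\gamma>0$, $x\in\mathbb R$; $E_{\alpha,\beta}=E_{\alpha,\beta}^1$. For $\lambda>0$ and $0<\alpha\le1$, $\{\hat N_\alpha(t)\}_{t\ge0}$ is the renewal counting process with $\hat N_\alpha(0)=0$ whose i.i.d. interarrival times have density $\lambda^2t^{2\alpha-1}E^2_{\alpha,2\alpha}(-\lambda t^\alpha)$, $t>0$. Its probability mass function is, for $n\ge0$, $$\Pr\{\hat N_\alpha(t)=n\}=\lambda^{2n}t^{2n\alpha}E_{\alpha,2n\alpha+1}^{2n+1}(-\lambda t^\alpha)+\lambda^{2n+1}t^{(2n+1)\alpha}E_{\alpha,(2n+1)\alpha+1}^{2n+2}(-\lambda t^\alpha),$$ and its mean is $\mathbb E(\hat N_\alpha(t))=\lambda^2t^{2\alpha}E_{\alpha,2\alpha+1}(-2\lambda t^\alpha)$. A distribution function $F$ of a positive random variable is subexponential if $\lim_{x\to\infty}\frac{1-F^{*2}(x)}{1-F(x)}=2$, where $F^{*2}$ is the twofold convolution of $F$. *)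

theory Defs
  imports "HOL-Probability.Probability"
begin

definition mittag_leffler3 :: "real \<Rightarrow> real \<Rightarrow> real \<Rightarrow> real \<Rightarrow> real" where
  "mittag_leffler3 \<alpha> \<beta> \<gamma> x =
     1 / Gamma \<gamma> * (\<Sum>j. Gamma (real j + \<gamma>) * x ^ j / (fact j * Gamma (real j * \<alpha> + \<beta>)))"

definition mittag_leffler :: "real \<Rightarrow> real \<Rightarrow> real \<Rightarrow> real" where
  "mittag_leffler \<alpha> \<beta> = mittag_leffler3 \<alpha> \<beta> 1"

definition interarrival_density :: "real \<Rightarrow> real \<Rightarrow> real \<Rightarrow> real" where
  "interarrival_density lam \<alpha> t =
     (if 0 < t
      then lam\<^sup>2 * t powr (2 * \<alpha> - 1) * mittag_leffler3 \<alpha> (2 * \<alpha>) 2 (- lam * t powr \<alpha>)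
      else 0)"

text \<open>
  The interarrival times \<open>W 1, W 2, \<dots>\<close> are positive everywhere, so \<open>N 0 = 0\<close>.  Infinitely
  many renewals in a bounded interval occur only on a null set; there \<open>card\<close> gives the value 0.
\<close>

definition renewal_counting_process ::
    "'a measure \<Rightarrow> (real \<Rightarrow> real) \<Rightarrow> (real \<Rightarrow> 'a \<Rightarrow> nat) \<Rightarrow> bool" where
  "renewal_counting_process M f N \<longleftrightarrow>
     (\<exists>W :: nat \<Rightarrow> 'a \<Rightarrow> real.
        prob_space.indep_vars M (\<lambda>_. borel) W {1..} \<and>
        (\<forall>i\<ge>1. distributed M lborel (W i) (\<lambda>x. ennreal (f x))) \<and>
        (\<forall>i\<ge>1. \<forall>\<omega>\<in>space M. 0 < W i \<omega>) \<and>
        (\<forall>t\<ge>0. \<forall>\<omega>\<in>space M. N t \<omega> = card {n. 1 \<le> n \<and> (\<Sum>i=1..n. W i \<omega>) \<le> t}))"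

text \<open>The \<open>\<sigma>\<close>-algebra on \<open>space M\<close> generated by the family \<open>Y i\<close>, \<open>i \<in> I\<close>, with values in \<open>S\<close>.\<close>

definition process_events ::
    "'a measure \<Rightarrow> 'b measure \<Rightarrow> 'i set \<Rightarrow> ('i \<Rightarrow> 'a \<Rightarrow> 'b) \<Rightarrow> 'a set set" where
  "process_events M S I Y =
     sigma_sets (space M) (\<Union>i\<in>I. {Y i -` A \<inter> space M | A. A \<in> sets S})"

text \<open>
  A distribution function \<open>F\<close> is represented by its law \<open>\<mu>\<close>, with \<open>F = cdf \<mu>\<close>; then \<open>F\<^sup>*\<^sup>2\<close> is the
  distribution function of \<open>\<mu> \<star> \<mu>\<close>.  As \<open>x / 0 = 0\<close>, the limit forces \<open>F x < 1\<close> for all \<open>x\<close>.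
\<close>

definition subexponential :: "real measure \<Rightarrow> bool" where
  "subexponential \<mu> \<longleftrightarrow>
     real_distribution \<mu> \<and> (AE x in \<mu>. 0 < x) \<and>
     ((\<lambda>x. (1 - cdf (\<mu> \<star> \<mu>) x) / (1 - cdf \<mu> x)) \<longlongrightarrow> 2) at_top"

definition risk_process ::
    "real \<Rightarrow> (real \<Rightarrow> 'a \<Rightarrow> nat) \<Rightarrow> (nat \<Rightarrow> 'a \<Rightarrow> real) \<Rightarrow> real \<Rightarrow> real \<Rightarrow> 'a \<Rightarrow> real" where
  "risk_process c N X z t \<omega> = z + c * t - (\<Sum>i=1..N t \<omega>. X i \<omega>)"

text \<open>If ruin never occurs, this is \<open>Inf {} = \<infinity>\<close>.\<close>

definition ruin_time :: "(real \<Rightarrow> 'a \<Rightarrow> real) \<Rightarrow> 'a \<Rightarrow> ereal" where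
  "ruin_time R \<omega> = Inf (ereal ` {t. 0 < t \<and> R t \<omega> < 0})"

definition ruin_probability :: "'a measure \<Rightarrow> (real \<Rightarrow> 'a \<Rightarrow> real) \<Rightarrow> real \<Rightarrow> real" where
  "ruin_probability M R t = measure M {\<omega> \<in> space M. ruin_time R \<omega> \<le> ereal t}"

end

theory Submission
  imports Defs
begin

text \<open>
  Between the claim sums at time \<open>t\<close> and the ruin event there is a pathwise sandwich.  If the
  claims up to time \<open>t\<close> exceed \<open>z + c * t\<close>, then ruin has occurred by time \<open>t\<close>; if ruin has occurred
  by time \<open>t\<close>, then (claims being positive and \<open>N\<close> nondecreasing) the claims up to time \<open>t\<close> exceed
  \<open>z\<close>.  A subexponential law is long-tailed, so the bounded shift \<open>c * t\<close> is invisible in the limit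
  and it remains to find the tail of the random sum \<open>X 1 + \<dots> + X (N t)\<close>.

  By independence this tail is a mixture, with weights \<open>P (N t = n)\<close>, of the tails of the sums of
  \<open>n\<close> claims.  Relative to the tail of one claim the latter tend to \<open>n\<close> (\<open>tail_ratio\<close>) and are at most
  \<open>K ^ n\<close> (\<open>tail_power_bound\<close>).  Since the interarrival times are positive, \<open>P (N t \<ge> n)\<close> decays
  faster than any geometric sequence (\<open>conv_cdf_exponential_bound\<close>).  Dominated convergence for series
  therefore gives the limit \<open>E (N t)\<close> (\<open>random_sum_tail\<close>), already with this crude bound in place
  of Kesten's inequality.

  The mean \<open>E (N t)\<close> is the sum over \<open>n \<ge> 1\<close> of the probabilities that the \<open>n\<close>-th renewal happens
  before \<open>t\<close>.  It is identified with the Mittag-Leffler expression because this is a locally bounded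
  solution of the renewal equation (\<open>mean_count_renewal\<close>), and such a solution is unique
  (\<open>renewal_equation_solution\<close>).  The equation is a comparison of coefficients: all functions
  involved are series in the kernels \<open>t powr (a - 1) / Gamma a\<close>, which form a convolution semigroup,
  so that convolving two series means taking the Cauchy product of their coefficients
  (\<open>gamma_series_conv\<close>).

  For this the interarrival density has to be a nonnegative function, since the law of
  the interarrival times only sees its positive part.  It is the convolution square of the
  Mittag-Leffler density \<open>lam * t powr (\<alpha> - 1) * E\<^sub>\<alpha>\<^sub>,\<^sub>\<alpha> (- lam * t powr \<alpha>)\<close>, which is the resolvent of
  the log-convex kernel \<open>lam * t powr (\<alpha> - 1) / Gamma \<alpha>\<close>; looking at a first zero shows that it is
  positive (\<open>ml_density_pos\<close>).
\<close>

section \<open>Series in Riemann--Liouville kernels\<close>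

text \<open>
  With \<open>a = real i * \<alpha> + b\<close> these are the terms of a Mittag-Leffler function multiplied by a
  power of \<open>t\<close>.  The normalisation by \<open>Gamma a\<close> makes them a convolution semigroup in \<open>a\<close>.
\<close>

definition rl_kernel :: "real \<Rightarrow> real \<Rightarrow> real" where
  "rl_kernel a t = (if 0 < t then t powr (a - 1) / Gamma a else 0)"

lemma rl_kernel_nonneg [simp]: "0 < a \<Longrightarrow> 0 \<le> rl_kernel a t"
  by (simp add: rl_kernel_def)

lemma rl_kernel_nonpos [simp]: "t \<le> 0 \<Longrightarrow> rl_kernel a t = 0"
  by (simp add: rl_kernel_def)

lemma rl_kernel_measurable [measurable]: "rl_kernel a \<in> borel_measurable borel"
  unfolding rl_kernel_def by measurable

text \<open>
  Scaling the integration variable by \<open>x\<close> turns the convolution into the Beta integral.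
\<close>

lemma nn_integral_rl_kernel_conv:
  assumes "0 < a" "0 < b"
  shows "(\<integral>\<^sup>+s. ennreal (rl_kernel a s * rl_kernel b (x - s)) \<partial>lborel) = ennreal (rl_kernel (a + b) x)"
proof (cases "0 < x")
  case False
  have "ennreal (rl_kernel a s * rl_kernel b (x - s)) = 0" for s
    using False by (cases "0 < s") (auto simp: rl_kernel_def)
  then show ?thesis using False by (simp only:) (simp add: rl_kernel_def)
next
  case True
  let ?h = "\<lambda>u. u powr (a - 1) * (1 - u) powr (b - 1)"
  have eq: "rl_kernel a (x * u) * rl_kernel b (x - x * u) =
      x powr (a + b - 2) / (Gamma a * Gamma b) * (?h u * indicator {0..1} u)" for u
  proof (cases "0 < u \<and> u < 1")
    case u: True
    have "x - x * u = x * (1 - u)" by (simp add: algebra_simps)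
    moreover have "a + b - 2 = (a - 1) + (b - 1)" by simp
    ultimately show ?thesis
      using u True by (simp only: powr_add rl_kernel_def) (simp add: powr_mult)
  next
    case u: False
    then consider "u < 0" | "u = 0" | "u = 1" | "u > 1" by linarith
    then show ?thesis
      using True by cases (auto simp: rl_kernel_def zero_less_mult_iff)
  qed
  have beta: "(\<integral>\<^sup>+u. ennreal (?h u * indicator {0..1} u) \<partial>lborel) = ennreal (Beta a b)"
    using nn_integral_has_integral_lebesgue[OF _ has_integral_Beta_real[OF assms]]
    by (simp add: mult_ac)
  have "(\<integral>\<^sup>+s. ennreal (rl_kernel a s * rl_kernel b (x - s)) \<partial>lborel) =
      ennreal x * (\<integral>\<^sup>+u. ennreal (rl_kernel a (x * u) * rl_kernel b (x - x * u)) \<partial>lborel)"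
    using True by (subst nn_integral_real_affine[where c = x and t = 0]) auto
  also have "\<dots> = ennreal x * (ennreal (x powr (a + b - 2) / (Gamma a * Gamma b)) * ennreal (Beta a b))"
    unfolding eq using assms beta
    by (subst ennreal_mult') (auto simp: nn_integral_cmult less_imp_le)
  also have "\<dots> = ennreal (x * (x powr (a + b - 2) / (Gamma a * Gamma b) * Beta a b))"
    using assms True by (simp add: ennreal_mult'[symmetric] ennreal_mult''[symmetric] less_imp_le Beta_def)
  also have "x * (x powr (a + b - 2) / (Gamma a * Gamma b) * Beta a b) = rl_kernel (a + b) x"
    using assms True Gamma_real_pos[of a] Gamma_real_pos[of b]
      powr_add[of x 1 "a + b - 2"] by (simp add: rl_kernel_def Beta_def less_imp_neq[symmetric])
  finally show ?thesis .
qed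

lemma rl_kernel_conv:
  assumes "0 < a" "0 < b"
  shows "has_bochner_integral lborel (\<lambda>s. rl_kernel a s * rl_kernel b (x - s)) (rl_kernel (a + b) x)"
  by (rule has_bochner_integral_nn_integral)
     (use assms nn_integral_rl_kernel_conv in auto)

text \<open>
  Restrict Euler's integral to \<open>{v..}\<close>, where \<open>u powr a\<close> is at least \<open>v powr a\<close>.  As \<open>v\<close> is arbitrary,
  this makes \<open>Gamma\<close> grow faster than every exponential, which is what the
  convergence of Mittag-Leffler type series needs.
\<close>

lemma Gamma_lower_bound:
  fixes a v :: real
  assumes "0 \<le> a" "0 < v"
  shows "v powr a * exp (- v) \<le> Gamma (a + 1)"
proof -
  have "ennreal (v powr a * exp (- v)) = (\<integral>\<^sup>+u. ennreal (v powr a) * (ennreal (exp (- u)) * indicator {v..} u) \<partial>lborel)"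
  proof -
    have deriv: "((\<lambda>u::real. - exp (- u)) has_real_derivative exp (- u)) (at u)" for u
      by (auto intro!: derivative_eq_intros)
    have "((\<lambda>u::real. - exp (- u)) \<longlongrightarrow> - 0) at_top"
      by (intro tendsto_minus) (auto intro!: filterlim_compose[OF exp_at_bot] filterlim_uminus_at_bot_at_top)
    then have "(\<integral>\<^sup>+u. ennreal (exp (- u)) * indicator {v..} u \<partial>lborel) = ennreal (exp (- v))"
      using nn_integral_FTC_atLeast[of "\<lambda>u. exp (- u)" v "\<lambda>u. - exp (- u)" 0] deriv
      by simp
    then show ?thesis by (simp add: nn_integral_cmult ennreal_mult')
  qed
  also have "\<dots> \<le> (\<integral>\<^sup>+u. ennreal (indicator {0..} u * u powr a / exp u) \<partial>lborel)"
  proof (rule nn_integral_mono)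
    fix u :: real
    show "ennreal (v powr a) * (ennreal (exp (- u)) * indicator {v..} u)
        \<le> ennreal (indicator {0..} u * u powr a / exp u)"
    proof (cases "v \<le> u")
      case True
      with assms have "v powr a * exp (- u) \<le> u powr a * exp (- u)"
        by (intro mult_right_mono powr_mono2) auto
      with True assms show ?thesis
        by (simp add: ennreal_mult'[symmetric] exp_minus divide_inverse ennreal_leI)
    qed simp
  qed
  also have "\<dots> = ennreal (Gamma (a + 1))"
    using Gamma_conv_nn_integral_real[of "a + 1"] assms by simp
  finally show ?thesis using assms by (simp)
qed

text \<open>
  A growth condition that is stable under Cauchy products and that makes every series in the kernels
  converge.
\<close>

definition geom_bounded :: "(nat \<Rightarrow> real) \<Rightarrow> bool" where
  "geom_bounded A \<longleftrightarrow> (\<exists>C\<ge>0. \<exists>r\<ge>0. \<forall>i. \<bar>A i\<bar> \<le> C * r ^ i)"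

lemma real_Suc_le_two_power: "real n + 1 \<le> 2 ^ n"
proof -
  have "Suc n \<le> 2 ^ n" by (simp add: Suc_leI)
  then have "real (Suc n) \<le> real (2 ^ n)" by (simp only: of_nat_le_iff)
  then show ?thesis by simp
qed

text \<open>
  The free parameter \<open>v\<close> of \<open>Gamma_lower_bound\<close> is chosen so large that the factor \<open>Gamma\<close> beats the
  geometric growth of the coefficients.
\<close>

lemma summable_gamma_series:
  assumes "geom_bounded A" "0 < \<alpha>" "0 < b"
  shows "summable (\<lambda>i. \<bar>A i\<bar> * rl_kernel (real i * \<alpha> + b) t)"
proof (cases "0 < t")
  case t: True
  obtain C r where C: "0 \<le> C" "0 \<le> r" "\<And>i. \<bar>A i\<bar> \<le> C * r ^ i"
    using assms by (auto simp: geom_bounded_def)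
  \<comment> \<open>With this \<open>v\<close> the terms are at most a constant times \<open>(2 * r / (4 * r + 1)) ^ i\<close>; the \<open>2\<close>
      absorbs the linear factor from \<open>Gamma (a + 1) = a * Gamma a\<close>.\<close>
  define v where "v = t * (4 * r + 1) powr (1 / \<alpha>)"
  have v: "0 < v" using t C by (simp add: v_def)
  have va: "v powr \<alpha> = t powr \<alpha> * (4 * r + 1)"
    using assms t C by (simp add: v_def powr_mult powr_powr)
  define q where "q = 2 * r / (4 * r + 1)"
  have q: "0 \<le> q" "q < 1" using C by (auto simp: q_def field_simps)
  show ?thesis
  proof (rule summable_comparison_test'[of "\<lambda>i. C * (\<alpha> + b) * exp v * t powr (b - 1) / v powr b * q ^ i" 0])
    show "summable (\<lambda>i. C * (\<alpha> + b) * exp v * t powr (b - 1) / v powr b * q ^ i)"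
      using q by (intro summable_mult summable_geometric) auto
    fix i :: nat
    let ?a = "real i * \<alpha> + b"
    have a: "0 < ?a" using assms by (simp add: add_nonneg_pos)
    have "v powr ?a * exp (- v) \<le> ?a * Gamma ?a"
      using Gamma_lower_bound[of ?a v] a v Gamma_plus1[of ?a] by (simp add: nonpos_Ints_def less_imp_le )
    then have G: "1 / Gamma ?a \<le> ?a * exp v / v powr ?a"
      using a v by (simp add: field_simps exp_minus)
    have "?a \<le> (\<alpha> + b) * (real i + 1)" using assms by (simp add: algebra_simps)
    also have "\<dots> \<le> (\<alpha> + b) * 2 ^ i"
      using assms
      by (intro mult_left_mono) (auto intro: real_Suc_le_two_power)
    finally have a2: "?a \<le> (\<alpha> + b) * 2 ^ i" .
    have tp: "t powr (?a - 1) = (t powr \<alpha>) ^ i * t powr (b - 1)" "v powr ?a = (v powr \<alpha>) ^ i * v powr b"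
      using t v by (simp_all add: powr_realpow[symmetric] powr_powr powr_add[symmetric] algebra_simps)
    have "\<bar>A i\<bar> * rl_kernel ?a t = \<bar>A i\<bar> * (t powr (?a - 1) * (1 / Gamma ?a))"
      using t by (simp add: rl_kernel_def)
    also have "\<dots> \<le> (C * r ^ i) * (t powr (?a - 1) * (((\<alpha> + b) * 2 ^ i) * exp v / v powr ?a))"
      using C a v G a2 
      by (intro mult_mono order.trans[OF G] divide_right_mono mult_right_mono) auto
    also have "\<dots> = C * (\<alpha> + b) * exp v * t powr (b - 1) / v powr b * q ^ i"
      using t C unfolding tp va q_def
      by (simp add: power_mult_distrib power_divide mult_ac)
    finally show "norm (\<bar>A i\<bar> * rl_kernel ?a t) \<le> C * (\<alpha> + b) * exp v * t powr (b - 1) / v powr b * q ^ i"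
      using a by simp
  qed
qed (simp)

definition gamma_series :: "real \<Rightarrow> real \<Rightarrow> (nat \<Rightarrow> real) \<Rightarrow> real \<Rightarrow> real" where
  "gamma_series \<alpha> b A t = (\<Sum>i. A i * rl_kernel (real i * \<alpha> + b) t)"

lemma gamma_series_measurable [measurable]: "gamma_series \<alpha> b A \<in> borel_measurable borel"
  unfolding gamma_series_def by measurable

lemma geom_bounded_Cauchy_product:
  assumes "geom_bounded A" "geom_bounded B"
  shows "geom_bounded (\<lambda>n. \<Sum>i\<le>n. \<bar>A i\<bar> * \<bar>B (n - i)\<bar>)"
proof -
  obtain C r where C: "0 \<le> C" "0 \<le> r" "\<And>i. \<bar>A i\<bar> \<le> C * r ^ i"
    using assms by (auto simp: geom_bounded_def)
  obtain D s where D: "0 \<le> D" "0 \<le> s" "\<And>i. \<bar>B i\<bar> \<le> D * s ^ i"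
    using assms by (auto simp: geom_bounded_def)
  let ?m = "max r s"
  have "\<bar>\<Sum>i\<le>n. \<bar>A i\<bar> * \<bar>B (n - i)\<bar>\<bar> \<le> C * D * (2 * ?m) ^ n" for n
  proof -
    have "\<bar>\<Sum>i\<le>n. \<bar>A i\<bar> * \<bar>B (n - i)\<bar>\<bar> = (\<Sum>i\<le>n. \<bar>A i\<bar> * \<bar>B (n - i)\<bar>)"
      by (simp add: sum_nonneg)
    also have "\<dots> \<le> (\<Sum>i\<le>n. (C * ?m ^ i) * (D * ?m ^ (n - i)))"
      using C D by (intro sum_mono mult_mono order.trans[OF C(3)] order.trans[OF D(3)] mult_left_mono power_mono) auto
    also have "\<dots> = (\<Sum>i\<le>n. C * D * ?m ^ n)"
      by (intro sum.cong) (auto simp: power_add[symmetric])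
    also have "\<dots> = (real n + 1) * (C * D * ?m ^ n)" by simp
    also have "\<dots> \<le> 2 ^ n * (C * D * ?m ^ n)"
      using C D by (intro mult_right_mono)
        (auto simp: le_max_iff_disj intro: real_Suc_le_two_power)
    finally show ?thesis by (simp add: power_mult_distrib mult_ac)
  qed
  then show ?thesis using C D unfolding geom_bounded_def
    by (intro exI[of _ "C * D"] conjI exI[of _ "2 * ?m"]) auto
qed

text \<open>
  The product of the two series is summed along the diagonals, so that the kernels in the \<open>n\<close>-th term
  have indices adding up to \<open>real n * \<alpha> + (a + b)\<close>, and is integrated term by term by the semigroup
  property.  Absolute convergence comes from the same computation with absolute values.
\<close>

lemma gamma_series_conv:
  assumes A: "geom_bounded A" and B: "geom_bounded B" and pos: "0 < \<alpha>" "0 < a" "0 < b"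
  shows "has_bochner_integral lborel (\<lambda>s. gamma_series \<alpha> a A s * gamma_series \<alpha> b B (x - s))
           (gamma_series \<alpha> (a + b) (\<lambda>n. \<Sum>i\<le>n. A i * B (n - i)) x)"
proof -
  define h where "h n s = (\<Sum>i\<le>n. (A i * rl_kernel (real i * \<alpha> + a) s) *
      (B (n - i) * rl_kernel (real (n - i) * \<alpha> + b) (x - s)))" for n s
  define h' where "h' n s = (\<Sum>i\<le>n. (\<bar>A i\<bar> * rl_kernel (real i * \<alpha> + a) s) *
      (\<bar>B (n - i)\<bar> * rl_kernel (real (n - i) * \<alpha> + b) (x - s)))" for n s
  have kpos: "0 \<le> rl_kernel (real i * \<alpha> + a) s" "0 \<le> rl_kernel (real i * \<alpha> + b) s" for i s
    using pos by (auto intro!: rl_kernel_nonneg add_nonneg_pos)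
  have term_int: "has_bochner_integral lborel
      (\<lambda>s. (u * rl_kernel (real i * \<alpha> + a) s) * (v * rl_kernel (real (n - i) * \<alpha> + b) (x - s)))
      (u * v * rl_kernel (real n * \<alpha> + (a + b)) x)" if "i \<le> n" for i n u v
  proof -
    have "has_bochner_integral lborel (\<lambda>s. (u * v) * (rl_kernel (real i * \<alpha> + a) s * rl_kernel (real (n - i) * \<alpha> + b) (x - s)))
       ((u * v) * rl_kernel ((real i * \<alpha> + a) + (real (n - i) * \<alpha> + b)) x)"
      using pos by (intro has_bochner_integral_mult_right rl_kernel_conv) (auto simp: add_nonneg_pos)
    moreover have "(real i * \<alpha> + a) + (real (n - i) * \<alpha> + b) = real n * \<alpha> + (a + b)"
      using that by (simp add: of_nat_diff algebra_simps)
    moreover have "(u * v) * (rl_kernel (real i * \<alpha> + a) s * rl_kernel (real (n - i) * \<alpha> + b) (x - s)) =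
        (u * rl_kernel (real i * \<alpha> + a) s) * (v * rl_kernel (real (n - i) * \<alpha> + b) (x - s))" for s
      by simp
    ultimately show ?thesis by (simp only:)
  qed
  have h_int: "has_bochner_integral lborel (h n)
      ((\<Sum>i\<le>n. A i * B (n - i)) * rl_kernel (real n * \<alpha> + (a + b)) x)" for n
    unfolding h_def sum_distrib_right by (intro has_bochner_integral_sum term_int) auto
  have h'_int: "has_bochner_integral lborel (h' n)
      ((\<Sum>i\<le>n. \<bar>A i\<bar> * \<bar>B (n - i)\<bar>) * rl_kernel (real n * \<alpha> + (a + b)) x)" for n
    unfolding h'_def sum_distrib_right by (intro has_bochner_integral_sum term_int) auto
  have hh': "\<bar>h n s\<bar> \<le> h' n s" for n s
    unfolding h_def h'_def using kpos by (intro order.trans[OF sum_abs] sum_mono) (auto simp: abs_mult simp del: of_nat_diff)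
  have sA: "summable (\<lambda>i. norm (A i * rl_kernel (real i * \<alpha> + a) s))"
    and sB: "summable (\<lambda>i. norm (B i * rl_kernel (real i * \<alpha> + b) s))" for s
    using summable_gamma_series[OF A pos(1,2)] summable_gamma_series[OF B pos(1,3)] kpos
    by (auto simp: abs_mult)
  have h_sums: "(\<lambda>n. h n s) sums (gamma_series \<alpha> a A s * gamma_series \<alpha> b B (x - s))" for s
    unfolding h_def gamma_series_def by (intro Cauchy_product_sums sA sB)
  have h'_sum: "summable (\<lambda>n. h' n s)" for s
  proof -
    have "summable (\<lambda>n. \<Sum>i\<le>n. norm (A i * rl_kernel (real i * \<alpha> + a) s) *
        norm (B (n - i) * rl_kernel (real (n - i) * \<alpha> + b) (x - s)))"
      using sA sB by (intro summable_Cauchy_product) auto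
    then show ?thesis using kpos by (simp add: h'_def abs_mult del: of_nat_diff)
  qed
  have h_abs: "summable (\<lambda>n. norm (h n s))" for s
    by (rule summable_comparison_test'[OF h'_sum, of 0]) (use hh' in auto)
  have n_sum: "summable (\<lambda>n. \<integral>s. norm (h n s) \<partial>lborel)"
  proof (rule summable_comparison_test'[of _ 0])
    show "summable (\<lambda>n. \<bar>\<Sum>i\<le>n. \<bar>A i\<bar> * \<bar>B (n - i)\<bar>\<bar> * rl_kernel (real n * \<alpha> + (a + b)) x)"
      using pos by (intro summable_gamma_series geom_bounded_Cauchy_product A B) auto
    fix n
    have "(\<integral>s. norm (h n s) \<partial>lborel) \<le> (\<integral>s. h' n s \<partial>lborel)"
      using h_int h'_int hh' by (intro integral_mono) (auto simp: has_bochner_integral_iff)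
    also have "\<dots> = (\<Sum>i\<le>n. \<bar>A i\<bar> * \<bar>B (n - i)\<bar>) * rl_kernel (real n * \<alpha> + (a + b)) x"
      using h'_int by (simp add: has_bochner_integral_iff)
    finally show "norm (\<integral>s. norm (h n s) \<partial>lborel) \<le>
        \<bar>\<Sum>i\<le>n. \<bar>A i\<bar> * \<bar>B (n - i)\<bar>\<bar> * rl_kernel (real n * \<alpha> + (a + b)) x"
      by (simp add: sum_nonneg)
  qed
  have int: "integrable lborel (h n)" for n
    using h_int by (simp add: has_bochner_integral_iff)
  have "integrable lborel (\<lambda>s. \<Sum>n. h n s)"
    using int h_abs n_sum by (intro integrable_suminf) auto
  moreover have "(\<integral>s. (\<Sum>n. h n s) \<partial>lborel) = (\<Sum>n. \<integral>s. h n s \<partial>lborel)"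
    using int h_abs n_sum by (intro integral_suminf) auto
  ultimately show ?thesis
    using h_sums h_int by (simp add: has_bochner_integral_iff sums_iff gamma_series_def)
qed

lemma geom_bounded_powers [simp]: "geom_bounded (\<lambda>i. c * r ^ i)"
  unfolding geom_bounded_def
  by (intro exI[of _ "\<bar>c\<bar>"] conjI exI[of _ "\<bar>r\<bar>"]) (auto simp: abs_mult power_abs)

lemma geom_bounded_Suc_powers [simp]: "geom_bounded (\<lambda>i. c * (real i + 1) * r ^ i)"
proof -
  have "\<bar>c * (real i + 1) * r ^ i\<bar> \<le> \<bar>c\<bar> * (2 * \<bar>r\<bar>) ^ i" for i
    using real_Suc_le_two_power[of i]
    by (auto simp: abs_mult power_abs power_mult_distrib mult.assoc intro!: mult_left_mono mult_right_mono)
  then show ?thesis unfolding geom_bounded_def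
    by (intro exI[of _ "\<bar>c\<bar>"] conjI exI[of _ "2 * \<bar>r\<bar>"]) auto
qed

lemma geom_bounded_unit [simp]: "geom_bounded (\<lambda>i. if i = 0 then c else 0)"
  unfolding geom_bounded_def
  by (intro exI[of _ "\<bar>c\<bar>"] conjI exI[of _ "0"]) auto

lemma gamma_series_unit: "gamma_series \<alpha> b (\<lambda>i. if i = 0 then c else 0) t = c * rl_kernel b t"
  unfolding gamma_series_def by (subst suminf_finite[of "{0}"]) auto

lemma gamma_series_nonpos [simp]: "t \<le> 0 \<Longrightarrow> gamma_series \<alpha> b A t = 0"
  by (simp add: gamma_series_def)

lemma summable_gamma_series':
  assumes "geom_bounded A" "0 < \<alpha>" "0 < b"
  shows "summable (\<lambda>i. A i * rl_kernel (real i * \<alpha> + b) t)"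
  by (rule summable_comparison_test'[OF summable_gamma_series[OF assms, of t], of 0])
     (use assms in \<open>simp add: abs_mult add_nonneg_pos\<close>)

lemma rl_kernel_1: "0 < t \<Longrightarrow> rl_kernel 1 t = 1" by (simp add: rl_kernel_def)

text \<open>
  Away from \<open>0\<close> the series is a power of \<open>t\<close> times an entire function of \<open>t powr \<alpha>\<close>; continuity and
  the behaviour at \<open>0\<close> are read off from this form.
\<close>

lemma gamma_series_factor:
  assumes "0 < t" and sm: "summable (\<lambda>i. A i / Gamma (real i * \<alpha> + b) * (t powr \<alpha>) ^ i)"
  shows "gamma_series \<alpha> b A t = t powr (b - 1) * (\<Sum>i. A i / Gamma (real i * \<alpha> + b) * (t powr \<alpha>) ^ i)"
proof -
  have "A i * rl_kernel (real i * \<alpha> + b) t = t powr (b - 1) * (A i / Gamma (real i * \<alpha> + b) * (t powr \<alpha>) ^ i)" for i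
  proof -
    have "t powr (real i * \<alpha> + b - 1) = t powr (b - 1) * (t powr \<alpha>) ^ i"
      using assms by (simp add: powr_realpow[symmetric] powr_powr powr_add[symmetric] algebra_simps)
    then show ?thesis using assms by (simp add: rl_kernel_def)
  qed
  then show ?thesis unfolding gamma_series_def using suminf_mult[OF sm, of "t powr (b - 1)"] by simp
qed

lemma summable_gamma_powser:
  assumes "geom_bounded A" "0 < \<alpha>" "0 < b"
  shows "summable (\<lambda>i. A i / Gamma (real i * \<alpha> + b) * y ^ i)"
proof (rule powser_inside[of _ "\<bar>y\<bar> + 1"])
  let ?t = "(\<bar>y\<bar> + 1) powr (1 / \<alpha>)"
  have t: "0 < ?t" "?t powr \<alpha> = \<bar>y\<bar> + 1" using assms by (auto simp: powr_powr add_pos_nonneg)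
  have "summable (\<lambda>i. A i * rl_kernel (real i * \<alpha> + b) ?t / ?t powr (b - 1))"
    using assms by (intro summable_divide summable_gamma_series')
  also have "(\<lambda>i. A i * rl_kernel (real i * \<alpha> + b) ?t / ?t powr (b - 1)) =
     (\<lambda>i. A i / Gamma (real i * \<alpha> + b) * (\<bar>y\<bar> + 1) ^ i)"
  proof
    fix i
    have "?t powr (real i * \<alpha> + b - 1) = ?t powr (b - 1) * (?t powr \<alpha>) ^ i"
      using assms by (simp add: powr_realpow[symmetric] powr_powr powr_add[symmetric] add_pos_nonneg
          add_divide_distrib diff_divide_distrib) (simp add: algebra_simps)
    then show "A i * rl_kernel (real i * \<alpha> + b) ?t / ?t powr (b - 1) = A i / Gamma (real i * \<alpha> + b) * (\<bar>y\<bar> + 1) ^ i"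
      using t by (simp add: rl_kernel_def)
  qed
  finally show "summable (\<lambda>i. A i / Gamma (real i * \<alpha> + b) * (\<bar>y\<bar> + 1) ^ i)" .
qed auto

lemma isCont_gamma_powser:
  assumes "geom_bounded A" "0 < \<alpha>" "0 < b"
  shows "isCont (\<lambda>y. \<Sum>i. A i / Gamma (real i * \<alpha> + b) * y ^ i) y"
  by (rule isCont_powser[of _ "\<bar>y\<bar> + 1"]) (use summable_gamma_powser[OF assms] in auto)

lemma continuous_on_gamma_series:
  assumes A: "geom_bounded A" and pos: "0 < \<alpha>" "0 < b"
  shows "continuous_on {0<..} (gamma_series \<alpha> b A)"
proof -
  define P where "P y = (\<Sum>i. A i / Gamma (real i * \<alpha> + b) * y ^ i)" for y
  have "isCont P y" for y
    unfolding P_def by (rule isCont_gamma_powser[OF assms])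
  then have "continuous_on UNIV P" by (simp add: continuous_at_imp_continuous_on)
  then have "continuous_on {0<..} (\<lambda>t. P (t powr \<alpha>))"
    by (rule continuous_on_compose2) (auto intro!: continuous_on_powr continuous_on_id continuous_on_const)
  then have "continuous_on {0<..} (\<lambda>t. t powr (b - 1) * P (t powr \<alpha>))"
    by (intro continuous_on_mult) (auto intro!: continuous_on_powr continuous_on_id continuous_on_const)
  moreover have "gamma_series \<alpha> b A t = t powr (b - 1) * P (t powr \<alpha>)" if "t \<in> {0<..}" for t
    using gamma_series_factor[OF _ summable_gamma_powser[OF assms]] that by (simp add: P_def)
  ultimately show ?thesis by (simp only: cong: continuous_on_cong)
qed

lemma gamma_series_pos_near_0:
  assumes A: "geom_bounded A" and pos: "0 < \<alpha>" "0 < b" and A0: "0 < A 0"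
  shows "\<exists>d>0. \<forall>t. 0 < t \<and> t < d \<longrightarrow> 0 < gamma_series \<alpha> b A t"
proof -
  let ?P = "\<lambda>y. \<Sum>i. A i / Gamma (real i * \<alpha> + b) * y ^ i"
  have "?P 0 = A 0 / Gamma b" using powser_zero[of "\<lambda>i. A i / Gamma (real i * \<alpha> + b)"] by simp
  then have P0: "0 < ?P 0" using pos A0 by simp
  have "((\<lambda>t::real. t powr \<alpha>) \<longlongrightarrow> 0) (at_right 0)"
    using pos by real_asymp
  then have "((\<lambda>t. ?P (t powr \<alpha>)) \<longlongrightarrow> ?P 0) (at_right 0)"
    by (rule isCont_tendsto_compose[OF isCont_gamma_powser[OF A pos]])
  then have "eventually (\<lambda>t. 0 < ?P (t powr \<alpha>)) (at_right 0)"
    using P0 by (rule order_tendstoD)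
  then obtain d where "0 < d" "\<And>t. 0 < t \<Longrightarrow> t < d \<Longrightarrow> 0 < ?P (t powr \<alpha>)"
    by (auto simp: eventually_at_right_field)
  then show ?thesis
    by (intro exI[of _ d]) (auto simp: gamma_series_factor[OF _ summable_gamma_powser[OF A pos]])
qed

lemma gamma_series_mono:
  assumes "geom_bounded A" "0 < \<alpha>" "1 \<le> b" "t \<le> x"
  shows "\<bar>gamma_series \<alpha> b A t\<bar> \<le> gamma_series \<alpha> b (\<lambda>i. \<bar>A i\<bar>) x"
proof -
  have b: "0 < b" using assms by simp
  have km: "0 \<le> rl_kernel (real i * \<alpha> + b) t \<and> rl_kernel (real i * \<alpha> + b) t \<le> rl_kernel (real i * \<alpha> + b) x" for i
  proof -
    have "0 \<le> real i * \<alpha>" using assms by simp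
    then have "0 < real i * \<alpha> + b" "0 \<le> real i * \<alpha> + b - 1" using assms by linarith+
    then show ?thesis using assms(4) by (auto simp: rl_kernel_def intro!: divide_right_mono powr_mono2)
  qed
  have "\<bar>gamma_series \<alpha> b A t\<bar> \<le> (\<Sum>i. \<bar>A i * rl_kernel (real i * \<alpha> + b) t\<bar>)"
    unfolding gamma_series_def
    by (intro summable_rabs) (use summable_gamma_series[OF assms(1,2) b] km in \<open>simp add: abs_mult\<close>)
  also have "\<dots> \<le> gamma_series \<alpha> b (\<lambda>i. \<bar>A i\<bar>) x"
    unfolding gamma_series_def
    using summable_gamma_series[OF assms(1,2) b] km
    by (intro suminf_le) (auto simp: abs_mult intro!: mult_left_mono)
  finally show ?thesis .
qed

section \<open>Positivity of the Mittag-Leffler density\<close>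

text \<open>
  The density of the Mittag-Leffler law: \<open>lam * t powr (\<alpha> - 1) * E\<^sub>\<alpha>\<^sub>,\<^sub>\<alpha> (- lam * t powr \<alpha>)\<close> for \<open>t > 0\<close>.
\<close>

definition ml_density :: "real \<Rightarrow> real \<Rightarrow> real \<Rightarrow> real" where
  "ml_density lam \<alpha> = gamma_series \<alpha> \<alpha> (\<lambda>i. lam * (- lam) ^ i)"

lemma ml_density_measurable [measurable]: "ml_density lam \<alpha> \<in> borel_measurable borel"
  unfolding ml_density_def by measurable

lemma sum_atMost_unit: fixes n :: nat shows "(\<Sum>i\<le>n. A i * (if n - i = 0 then c else 0)) = A n * (c::real)"
proof -
  have "(\<Sum>i\<le>n. A i * (if n - i = 0 then c else 0)) = (\<Sum>i\<in>{n}. A i * (if n - i = 0 then c else 0))"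
    by (intro sum.mono_neutral_right) auto
  then show ?thesis by simp
qed

lemma gamma_series_rl_kernel_conv:
  assumes "geom_bounded A" "0 < \<alpha>" "0 < a" "0 < b"
  shows "has_bochner_integral lborel (\<lambda>s. gamma_series \<alpha> a A s * rl_kernel b (x - s)) (gamma_series \<alpha> (a + b) A x)"
  using gamma_series_conv[OF assms(1) geom_bounded_unit[of 1] assms(2-4), of x]
  unfolding gamma_series_unit sum_atMost_unit by simp

text \<open>
  The coefficients form a geometric series, so multiplying them by \<open>- lam\<close> shifts them by one place.
  Hence the density \<open>g\<close> solves \<open>g + k * g = k\<close> (convolution) for the kernel \<open>k = lam * rl_kernel \<alpha>\<close>: it is
  the resolvent of \<open>k\<close>.
\<close>

lemma ml_density_volterra:
  assumes "0 < \<alpha>"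
  shows "has_bochner_integral lborel (\<lambda>s. ml_density lam \<alpha> s * (lam * rl_kernel \<alpha> (t - s)))
           (lam * rl_kernel \<alpha> t - ml_density lam \<alpha> t)"
proof -
  let ?A = "\<lambda>i. lam * (- lam) ^ i"
  have "has_bochner_integral lborel (\<lambda>s. (ml_density lam \<alpha> s * rl_kernel \<alpha> (t - s)) * lam)
      (gamma_series \<alpha> (\<alpha> + \<alpha>) ?A t * lam)"
    unfolding ml_density_def
    using assms by (intro has_bochner_integral_mult_left gamma_series_rl_kernel_conv) auto
  moreover have "gamma_series \<alpha> (\<alpha> + \<alpha>) ?A t * lam = lam * rl_kernel \<alpha> t - ml_density lam \<alpha> t"
  proof -
    have s: "summable (\<lambda>i. ?A i * rl_kernel (real i * \<alpha> + \<alpha>) t)"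
      and s2: "summable (\<lambda>i. ?A i * rl_kernel (real i * \<alpha> + (\<alpha> + \<alpha>)) t)"
      using assms by (intro summable_gamma_series'; simp)+
    have "ml_density lam \<alpha> t = lam * rl_kernel \<alpha> t + (\<Sum>i. ?A (Suc i) * rl_kernel (real (Suc i) * \<alpha> + \<alpha>) t)"
      using suminf_split_head[OF s] by (simp add: ml_density_def gamma_series_def)
    also have "(\<lambda>i. ?A (Suc i) * rl_kernel (real (Suc i) * \<alpha> + \<alpha>) t) =
        (\<lambda>i. - lam * (?A i * rl_kernel (real i * \<alpha> + (\<alpha> + \<alpha>)) t))"
      by (simp add: fun_eq_iff algebra_simps)
    also have "(\<Sum>i. - lam * (?A i * rl_kernel (real i * \<alpha> + (\<alpha> + \<alpha>)) t)) =
        - lam * gamma_series \<alpha> (\<alpha> + \<alpha>) ?A t"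
      unfolding gamma_series_def by (rule suminf_mult[OF s2])
    finally show ?thesis by simp
  qed
  ultimately show ?thesis by (simp add: mult_ac)
qed

text \<open>
  Log-convexity of the kernel, in the form used at a first zero of the density: moving both
  arguments from \<open>t\<close> to \<open>t0\<close> decreases \<open>k (t - s)\<close> by a larger factor than \<open>k t\<close>.
\<close>

lemma rl_kernel_log_convex:
  assumes "0 < \<alpha>" "\<alpha> \<le> 1" "0 < s" "s < t" "t \<le> t0"
  shows "rl_kernel \<alpha> (t0 - s) \<le> (t0 / t) powr (\<alpha> - 1) * rl_kernel \<alpha> (t - s)"
proof -
  have le: "(t - s) * (t0 / t) \<le> t0 - s"
    using assms by (simp add: field_simps)
  have "(t0 - s) powr (\<alpha> - 1) \<le> ((t - s) * (t0 / t)) powr (\<alpha> - 1)"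
    using assms le by (intro powr_mono2') auto
  also have "\<dots> = (t - s) powr (\<alpha> - 1) * (t0 / t) powr (\<alpha> - 1)"
    using assms by (intro powr_mult) 
  finally have "(t0 - s) powr (\<alpha> - 1) / Gamma \<alpha> \<le> (t - s) powr (\<alpha> - 1) * (t0 / t) powr (\<alpha> - 1) / Gamma \<alpha>"
    using assms by (intro divide_right_mono) auto
  with assms show ?thesis by (simp add: rl_kernel_def mult_ac)
qed

text \<open>
  Let \<open>t0\<close> be the first zero of \<open>g\<close>, and let \<open>t1 < t0\<close> be a point where \<open>g\<close> is maximal on a short
  interval \<open>{t0 - h..t0}\<close>.  Subtract \<open>R = k t0 / k t1\<close> times the Volterra equation at \<open>t1\<close> from that at
  \<open>t0\<close>.  The source terms cancel; on \<open>{0<..<t1}\<close> the integrands compare favourably by log-convexity; on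
  \<open>{t1..t0}\<close> one loses at most \<open>g t1\<close> times the integral of \<open>k\<close> over \<open>{0..h}\<close>.  For small \<open>h\<close> this is less
  than \<open>R * g t1\<close>, so that \<open>g t0 > 0\<close>, a contradiction.
\<close>

lemma ml_density_pos:
  assumes "0 < lam" "0 < \<alpha>" "\<alpha> \<le> 1" "0 < t"
  shows "0 < ml_density lam \<alpha> t"
proof (rule ccontr)
  let ?g = "ml_density lam \<alpha>"
  define Z where "Z = {t. 0 < t \<and> ?g t \<le> 0}"
  define t0 where "t0 = Inf Z"
  assume "\<not> 0 < ?g t"
  then have Zne: "Z \<noteq> {}" using assms by (auto simp: Z_def)
  have cont: "continuous_on {0<..} ?g"
    unfolding ml_density_def using assms by (intro continuous_on_gamma_series) auto
  obtain d where d: "0 < d" "\<And>s. 0 < s \<Longrightarrow> s < d \<Longrightarrow> 0 < ?g s"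
    using gamma_series_pos_near_0[of "\<lambda>i. lam * (- lam) ^ i" \<alpha> \<alpha>] assms
    unfolding ml_density_def by auto
  have bdd: "bdd_below Z" by (intro bdd_belowI[of _ 0]) (auto simp: Z_def)
  have dZ: "d \<le> z" if "z \<in> Z" for z using d that by (force simp: Z_def)
  then have t0: "d \<le> t0" unfolding t0_def using Zne by (intro cInf_greatest)
  then have t0pos: "0 < t0" using d by simp
  have before: "0 < ?g s" if "0 < s" "s < t0" for s
  proof (rule ccontr)
    assume "\<not> 0 < ?g s"
    then have "s \<in> Z" using that by (simp add: Z_def)
    then have "t0 \<le> s" unfolding t0_def by (rule cInf_lower[OF _ bdd])
    with that show False by simp
  qed
  have g0: "?g t0 \<le> 0"
  proof (rule ccontr)
    assume "\<not> ?g t0 \<le> 0"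
    then have "0 < ?g t0" by simp
    moreover have "isCont ?g t0"
      using cont t0pos by (simp add: continuous_on_eq_continuous_at)
    ultimately have "eventually (\<lambda>s. 0 < ?g s) (nhds t0)"
      by (auto simp: isCont_def tendsto_at_iff_tendsto_nhds intro: order_tendstoD(1))
    then obtain e where e: "0 < e" "\<And>s. dist s t0 < e \<Longrightarrow> 0 < ?g s"
      by (auto simp: eventually_nhds_metric)
    obtain z where z: "z \<in> Z" "z < t0 + e"
      using cInf_lessD[OF Zne, of "t0 + e"] e by (auto simp: t0_def)
    moreover have "t0 \<le> z" unfolding t0_def by (rule cInf_lower[OF z(1) bdd])
    ultimately show False using e(2)[of z] by (auto simp: Z_def dist_real_def)
  qed
  have "((\<lambda>h. lam * (h powr \<alpha> / Gamma (\<alpha> + 1))) \<longlongrightarrow> lam * (0 / Gamma (\<alpha> + 1))) (at_right 0)"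
  proof (intro tendsto_intros)
    show "((\<lambda>h::real. h powr \<alpha>) \<longlongrightarrow> 0) (at_right 0)" using assms by real_asymp
    show "Gamma (\<alpha> + 1) \<noteq> 0" using Gamma_real_pos[of "\<alpha> + 1"] assms by linarith
  qed
  then have "eventually (\<lambda>h. lam * (h powr \<alpha> / Gamma (\<alpha> + 1)) < 1/2) (at_right 0)"
    by (rule order_tendstoD) simp
  then obtain b where b: "0 < b" "\<And>h. 0 < h \<Longrightarrow> h < b \<Longrightarrow> lam * (h powr \<alpha> / Gamma (\<alpha> + 1)) < 1/2"
    by (auto simp: eventually_at_right_field)
  \<comment> \<open>\<open>h \<le> t0 / 2\<close> keeps \<open>t1\<close> in \<open>{t0 / 2..t0}\<close>, so that \<open>R \<ge> 1 / 2\<close>; \<open>h < b\<close> makes the integral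
      of the kernel over \<open>{0..h}\<close> smaller than \<open>1 / 2\<close>.\<close>
  define h where "h = min (b / 2) (t0 / 2)"
  have h: "0 < h" "h \<le> t0 / 2" "h < b" using b(1) t0pos by (auto simp: h_def)
  obtain t1 where t1: "t1 \<in> {t0 - h..t0}" "\<And>s. s \<in> {t0 - h..t0} \<Longrightarrow> ?g s \<le> ?g t1"
  proof -
    have "continuous_on {t0 - h..t0} ?g"
      using h t0pos by (intro continuous_on_subset[OF cont]) auto
    then show ?thesis using h that continuous_attains_sup[of "{t0 - h..t0}" ?g] by auto
  qed
  have g1: "0 < ?g t1"
    using before[of "t0 - h"] t1(2)[of "t0 - h"] h t0pos by auto
  have t1': "0 < t1" "t1 < t0" "t0 / 2 \<le> t1"
    using g1 g0 t1(1) h t0pos by (auto simp: less_le)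
  define R where "R = (t0 / t1) powr (\<alpha> - 1)"
  have R: "1 / 2 \<le> R"
  proof -
    have "1 / 2 \<le> (2::real) powr (\<alpha> - 1)"
      using powr_mono[of "-1" "\<alpha> - 1" "2::real"] assms by (simp add: powr_minus)
    also have "\<dots> \<le> R"
      unfolding R_def using assms t1' t0pos by (intro powr_mono2') (auto simp: field_simps)
    finally show ?thesis .
  qed
  have kR: "R * rl_kernel \<alpha> t1 = rl_kernel \<alpha> t0"
    using t1' t0pos by (simp add: R_def rl_kernel_def powr_divide)
  have i1: "has_bochner_integral lborel
      (\<lambda>s. R * (?g s * (lam * rl_kernel \<alpha> (t1 - s))) - ?g s * (lam * rl_kernel \<alpha> (t0 - s)))
      (R * (lam * rl_kernel \<alpha> t1 - ?g t1) - (lam * rl_kernel \<alpha> t0 - ?g t0))"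
    using assms by (intro has_bochner_integral_diff has_bochner_integral_mult_right ml_density_volterra)
  have i2: "has_bochner_integral lborel (\<lambda>s. - ?g t1 * (lam * (rl_kernel 1 (s - t1) * rl_kernel \<alpha> (t0 - s))))
      (- ?g t1 * (lam * rl_kernel (\<alpha> + 1) (t0 - t1)))"
  proof -
    have "has_bochner_integral lborel (\<lambda>s. rl_kernel 1 s * rl_kernel \<alpha> ((t0 - t1) - s)) (rl_kernel (1 + \<alpha>) (t0 - t1))"
      using assms by (intro rl_kernel_conv) auto
    then have "has_bochner_integral lborel (\<lambda>s. rl_kernel 1 (- t1 + 1 * s) * rl_kernel \<alpha> ((t0 - t1) - (- t1 + 1 * s)))
        (rl_kernel (1 + \<alpha>) (t0 - t1) /\<^sub>R \<bar>1\<bar>)"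
      by (subst lborel_has_bochner_integral_real_affine_iff[of 1 _ _ "- t1", symmetric]) (auto)
    then show ?thesis
      by (intro has_bochner_integral_mult_right) (simp add: add.commute)
  qed
  have "- ?g t1 * (lam * rl_kernel (\<alpha> + 1) (t0 - t1)) \<le> R * (lam * rl_kernel \<alpha> t1 - ?g t1) - (lam * rl_kernel \<alpha> t0 - ?g t0)"
    using has_bochner_integral_integral_eq[OF i1, symmetric] has_bochner_integral_integral_eq[OF i2, symmetric]
  proof (elim ssubst, intro integral_mono_AE)
    show "AE s in lborel. - ?g t1 * (lam * (rl_kernel 1 (s - t1) * rl_kernel \<alpha> (t0 - s)))
        \<le> R * (?g s * (lam * rl_kernel \<alpha> (t1 - s))) - ?g s * (lam * rl_kernel \<alpha> (t0 - s))"
      using AE_lborel_singleton[of t1]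
    proof eventually_elim
      case (elim s)
      have gs: "?g s = 0" if "s \<le> 0" using that by (simp add: ml_density_def)
      consider "s \<le> 0" | "0 < s" "s < t1" | "t1 < s" "s < t0" | "t0 \<le> s" using elim by linarith
      then show ?case
      proof cases
        case 1
        then show ?thesis using gs t1' by simp
      next
        case 2
        have "?g s * (lam * rl_kernel \<alpha> (t0 - s)) \<le> ?g s * (lam * (R * rl_kernel \<alpha> (t1 - s)))"
          unfolding R_def using 2 t1' assms less_imp_le[OF before[of s]]
          by (intro mult_left_mono rl_kernel_log_convex) auto
        with 2 show ?thesis by (simp add: mult_ac)
      next
        case 3
        have "?g s * (lam * rl_kernel \<alpha> (t0 - s)) \<le> ?g t1 * (lam * rl_kernel \<alpha> (t0 - s))"
          using 3 t1' t1(1) assms by (intro mult_right_mono t1(2)) auto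
        with 3 show ?thesis by (simp add: rl_kernel_1)
      next
        case 4
        then show ?thesis using t1' by simp
      qed
    qed
  qed (use i1 i2 in \<open>auto simp: has_bochner_integral_iff\<close>)
  moreover have "R * (lam * rl_kernel \<alpha> t1 - ?g t1) - (lam * rl_kernel \<alpha> t0 - ?g t0) = ?g t0 - R * ?g t1"
    using kR by (simp add: algebra_simps)
  moreover have "lam * rl_kernel (\<alpha> + 1) (t0 - t1) < 1 / 2"
  proof -
    have "0 < t0 - t1" "t0 - t1 < b" using t1' t1(1) h by auto
    from b(2)[OF this] this show ?thesis by (simp add: rl_kernel_def)
  qed
  then have "?g t1 * (lam * rl_kernel (\<alpha> + 1) (t0 - t1)) < ?g t1 * R"
    using g1 R by (intro mult_strict_left_mono) auto
  ultimately show False using g0 by (simp add: mult_ac)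
qed

section \<open>The interarrival density and the renewal equation\<close>

lemma Gamma_shifted_fact:
  "Gamma (real j + 1) = fact j" "Gamma (real j + 2) = (real j + 1) * fact j"
  using Gamma_fact[of j, where ?'a = real] Gamma_fact[of "Suc j", where ?'a = real]
  by (simp_all add: add_ac)

lemma mittag_leffler_eq_gamma_series:
  assumes "0 < t" "0 < \<alpha>"
  shows "lam\<^sup>2 * t powr (2 * \<alpha>) * mittag_leffler \<alpha> (2 * \<alpha> + 1) (- 2 * lam * t powr \<alpha>) =
    gamma_series \<alpha> (2 * \<alpha> + 1) (\<lambda>i. lam\<^sup>2 * (- 2 * lam) ^ i) t"
proof -
  let ?B = "\<lambda>i. lam\<^sup>2 * (- 2 * lam) ^ i" and ?b = "2 * \<alpha> + 1"
  have s: "summable (\<lambda>i. ?B i / Gamma (real i * \<alpha> + ?b) * (t powr \<alpha>) ^ i)"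
    using assms by (intro summable_gamma_powser) auto
  have s': "summable (\<lambda>i. (- 2 * lam) ^ i / Gamma (real i * \<alpha> + ?b) * (t powr \<alpha>) ^ i)"
    using summable_gamma_powser[OF geom_bounded_powers[of 1 "- 2 * lam"], of \<alpha> ?b "t powr \<alpha>"] assms by simp
  have "mittag_leffler \<alpha> ?b (- 2 * lam * t powr \<alpha>) =
      (\<Sum>i. (- 2 * lam) ^ i / Gamma (real i * \<alpha> + ?b) * (t powr \<alpha>) ^ i)"
    unfolding mittag_leffler_def mittag_leffler3_def Gamma_shifted_fact power_mult_distrib
    by (simp add: mult_ac)
  moreover have "?B i / Gamma (real i * \<alpha> + ?b) * (t powr \<alpha>) ^ i =
      lam\<^sup>2 * ((- 2 * lam) ^ i / Gamma (real i * \<alpha> + ?b) * (t powr \<alpha>) ^ i)" for i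
    by simp
  ultimately show ?thesis
    unfolding gamma_series_factor[OF assms(1) s] using suminf_mult[OF s', of "lam\<^sup>2"]
    by (simp only:) simp
qed

lemma interarrival_density_eq_gamma_series:
  assumes "0 < \<alpha>"
  shows "interarrival_density lam \<alpha> = gamma_series \<alpha> (2 * \<alpha>) (\<lambda>i. lam\<^sup>2 * (real i + 1) * (- lam) ^ i)"
proof
  fix t
  let ?A = "\<lambda>i. (real i + 1) * (- lam) ^ i"
  show "interarrival_density lam \<alpha> t = gamma_series \<alpha> (2 * \<alpha>) (\<lambda>i. lam\<^sup>2 * (real i + 1) * (- lam) ^ i) t"
  proof (cases "0 < t")
    case True
    have s: "summable (\<lambda>i. lam\<^sup>2 * (real i + 1) * (- lam) ^ i / Gamma (real i * \<alpha> + 2 * \<alpha>) * (t powr \<alpha>) ^ i)"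
      using assms by (intro summable_gamma_powser) auto
    have s': "summable (\<lambda>i. ?A i / Gamma (real i * \<alpha> + 2 * \<alpha>) * (t powr \<alpha>) ^ i)"
      using summable_gamma_powser[OF geom_bounded_Suc_powers[of 1 "- lam"], of \<alpha> "2 * \<alpha>" "t powr \<alpha>"] assms by simp
    have "Gamma (real j + 2) * (- lam * t powr \<alpha>) ^ j / (fact j * Gamma (real j * \<alpha> + 2 * \<alpha>)) =
        ?A j / Gamma (real j * \<alpha> + 2 * \<alpha>) * (t powr \<alpha>) ^ j" for j
      unfolding Gamma_shifted_fact power_mult_distrib by simp
    then have "mittag_leffler3 \<alpha> (2 * \<alpha>) 2 (- lam * t powr \<alpha>) =
        (\<Sum>i. ?A i / Gamma (real i * \<alpha> + 2 * \<alpha>) * (t powr \<alpha>) ^ i)"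
      using Gamma_shifted_fact(2)[of 0] by (simp add: mittag_leffler3_def del: mult_minus_left)
    moreover have "lam\<^sup>2 * (real i + 1) * (- lam) ^ i / Gamma (real i * \<alpha> + 2 * \<alpha>) * (t powr \<alpha>) ^ i =
        lam\<^sup>2 * (?A i / Gamma (real i * \<alpha> + 2 * \<alpha>) * (t powr \<alpha>) ^ i)" for i
      by simp
    ultimately show ?thesis
      unfolding gamma_series_factor[OF True s] interarrival_density_def
      using True suminf_mult[OF s', of "lam\<^sup>2"] by (simp only:) simp
  qed (simp add: interarrival_density_def)
qed

lemma interarrival_density_measurable [measurable]:
  "0 < \<alpha> \<Longrightarrow> interarrival_density lam \<alpha> \<in> borel_measurable borel"
  by (simp add: interarrival_density_eq_gamma_series)

text \<open>
  Each interarrival time behaves like the sum of two independent Mittag-Leffler times.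
\<close>

lemma interarrival_density_conv:
  assumes "0 < \<alpha>"
  shows "has_bochner_integral lborel (\<lambda>s. ml_density lam \<alpha> s * ml_density lam \<alpha> (t - s))
           (interarrival_density lam \<alpha> t)"
proof -
  have "(\<Sum>i\<le>n. (lam * (- lam) ^ i) * (lam * (- lam) ^ (n - i))) = lam\<^sup>2 * (real n + 1) * (- lam) ^ n" for n
  proof -
    have "(\<Sum>i\<le>n. (lam * (- lam) ^ i) * (lam * (- lam) ^ (n - i))) = (\<Sum>i\<le>n. lam\<^sup>2 * (- lam) ^ n)"
      by (intro sum.cong) (auto simp: power2_eq_square power_add[symmetric])
    then show ?thesis by (simp add: algebra_simps)
  qed
  with gamma_series_conv[of "\<lambda>i. lam * (- lam) ^ i" "\<lambda>i. lam * (- lam) ^ i" \<alpha> \<alpha> \<alpha> t] assms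
  show ?thesis
    unfolding interarrival_density_eq_gamma_series[OF assms] ml_density_def mult_2 by simp
qed

lemma interarrival_density_pos:
  assumes "0 < lam" "0 < \<alpha>" "\<alpha> \<le> 1" "0 < t"
  shows "0 < interarrival_density lam \<alpha> t"
proof -
  let ?h = "\<lambda>s. ml_density lam \<alpha> s * ml_density lam \<alpha> (t - s)"
  have pos: "0 < ?h s" if "0 < s" "s < t" for s
    using assms that by (intro mult_pos_pos ml_density_pos) auto
  have zero: "ml_density lam \<alpha> s = 0" if "s \<le> 0" for s
    using that by (simp add: ml_density_def)
  have nn: "0 \<le> ?h s" for s
    using pos[of s] zero[of s] zero[of "t - s"] by (cases "0 < s \<and> s < t") auto
  note h = interarrival_density_conv[of \<alpha> lam t, OF assms(2)]
  have "0 \<le> interarrival_density lam \<alpha> t"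
    unfolding has_bochner_integral_integral_eq[OF h, symmetric]
    by (rule Bochner_Integration.integral_nonneg) (rule nn)
  moreover have "interarrival_density lam \<alpha> t \<noteq> 0"
  proof
    assume "interarrival_density lam \<alpha> t = 0"
    then have "AE s in lborel. ?h s = 0"
      using h nn integral_nonneg_eq_0_iff_AE[of lborel ?h] by (simp add: has_bochner_integral_iff)
    then have "AE s in lborel. s \<notin> {0<..<t}"
      by eventually_elim (use pos in force)
    then have "emeasure lborel {0<..<t} = 0"
      by (subst (asm) AE_iff_measurable[of "{0<..<t}"]) auto
    then show False using assms by simp
  qed
  ultimately show ?thesis by simp
qed

lemma interarrival_density_nonneg:
  assumes "0 < lam" "0 < \<alpha>" "\<alpha> \<le> 1"
  shows "0 \<le> interarrival_density lam \<alpha> t"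
  using interarrival_density_pos[OF assms, of t] by (cases "0 < t") (auto simp: interarrival_density_def)

text \<open>
  The integral of the interarrival density: convolution with \<open>rl_kernel 1\<close>, the indicator of the positive
  half-line, raises the index by one.
\<close>

definition interarrival_cdf :: "real \<Rightarrow> real \<Rightarrow> real \<Rightarrow> real" where
  "interarrival_cdf lam \<alpha> = gamma_series \<alpha> (2 * \<alpha> + 1) (\<lambda>i. lam\<^sup>2 * (real i + 1) * (- lam) ^ i)"

text \<open>
  The Mittag-Leffler expression for the mean, see \<open>mittag_leffler_eq_gamma_series\<close>.
\<close>

definition mean_count :: "real \<Rightarrow> real \<Rightarrow> real \<Rightarrow> real" where
  "mean_count lam \<alpha> = gamma_series \<alpha> (2 * \<alpha> + 1) (\<lambda>i. lam\<^sup>2 * (- 2 * lam) ^ i)"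

lemma has_integral_interarrival_cdf:
  assumes "0 < \<alpha>"
  shows "has_bochner_integral lborel (\<lambda>s. interarrival_density lam \<alpha> s * rl_kernel 1 (x - s)) (interarrival_cdf lam \<alpha> x)"
  unfolding interarrival_density_eq_gamma_series[OF assms] interarrival_cdf_def
  using assms by (intro gamma_series_rl_kernel_conv) auto

lemma sum_Suc_times_power2: "(\<Sum>i\<le>m. (real i + 1) * 2 ^ (m - i)) = 2 ^ (m + 2) - (real m + 3)"
proof (induction m)
  case (Suc m)
  have "(\<Sum>i\<le>Suc m. (real i + 1) * 2 ^ (Suc m - i)) = 2 * (\<Sum>i\<le>m. (real i + 1) * 2 ^ (m - i)) + (real m + 2)"
    by (simp add: sum_distrib_left Suc_diff_le mult_ac)
  then show ?case using Suc by simp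
qed simp

text \<open>
  In terms of the generating functions \<open>A = (lam * x / (1 + lam * x))\<^sup>2\<close> of the density and
  \<open>B = lam\<^sup>2 * x\<^sup>2 / (1 + 2 * lam * x)\<close> of the mean, this is the identity \<open>B = A + A * B\<close>.  The
  series for \<open>B - A\<close> starts two places later, which accounts for the index \<open>2 * \<alpha> + (2 * \<alpha> + 1)\<close> of the
  convolution.
\<close>

lemma mean_count_renewal:
  assumes "0 < \<alpha>"
  shows "has_bochner_integral lborel (\<lambda>s. interarrival_density lam \<alpha> s * mean_count lam \<alpha> (x - s))
           (mean_count lam \<alpha> x - interarrival_cdf lam \<alpha> x)"
proof -
  let ?A = "\<lambda>i. lam\<^sup>2 * (real i + 1) * (- lam) ^ i" and ?B = "\<lambda>i. lam\<^sup>2 * (- 2 * lam) ^ i"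
  let ?C = "\<lambda>n. \<Sum>i\<le>n. ?A i * ?B (n - i)"
  let ?k = "\<lambda>i. rl_kernel (real i * \<alpha> + (2 * \<alpha> + 1)) x"
  have C: "?C m = ?B (m + 2) - ?A (m + 2)" for m
  proof -
    have "?C m = (\<Sum>i\<le>m. lam\<^sup>2 * (- lam) ^ (m + 2) * ((real i + 1) * 2 ^ (m - i)))"
    proof (intro sum.cong refl)
      fix i assume "i \<in> {..m}"
      then have "(- lam) ^ (m + 2) = (- lam) ^ i * (- lam) ^ (m - i) * lam\<^sup>2"
        by (simp add: power_add[symmetric] power2_eq_square)
      moreover have "(- 2 * lam) ^ (m - i) = 2 ^ (m - i) * (- lam) ^ (m - i)"
        by (simp add: power_mult_distrib[symmetric])
      ultimately show "?A i * ?B (m - i) = lam\<^sup>2 * (- lam) ^ (m + 2) * ((real i + 1) * 2 ^ (m - i))"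
        by simp
    qed
    also have "\<dots> = lam\<^sup>2 * (- lam) ^ (m + 2) * (2 ^ (m + 2) - (real m + 3))"
      by (simp only: sum_distrib_left[symmetric] sum_Suc_times_power2)
    also have "\<dots> = ?B (m + 2) - ?A (m + 2)"
    proof -
      have "(- 2 * lam) ^ (m + 2) = 2 ^ (m + 2) * (- lam) ^ (m + 2)"
        by (simp only: power_mult_distrib[symmetric]) simp
      then show ?thesis by (simp only: right_diff_distrib of_nat_add) (simp add: algebra_simps)
    qed
    finally show ?thesis .
  qed
  have sB: "summable (\<lambda>i. ?B i * ?k i)" and sA: "summable (\<lambda>i. ?A i * ?k i)"
    using assms by (intro summable_gamma_series'; simp)+
  have "(\<lambda>i. ?B i * ?k i - ?A i * ?k i) sums (mean_count lam \<alpha> x - interarrival_cdf lam \<alpha> x)"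
    unfolding mean_count_def interarrival_cdf_def gamma_series_def
    by (intro sums_diff summable_sums sA sB)
  \<comment> \<open>The coefficients of orders \<open>0\<close> and \<open>1\<close> agree.\<close>
  then have "(\<lambda>i. ?B (i + 2) * ?k (i + 2) - ?A (i + 2) * ?k (i + 2)) sums
      (mean_count lam \<alpha> x - interarrival_cdf lam \<alpha> x)"
    by (subst sums_iff_shift) (simp add: numeral_2_eq_2)
  also have "(\<lambda>i. ?B (i + 2) * ?k (i + 2) - ?A (i + 2) * ?k (i + 2)) =
      (\<lambda>i. ?C i * rl_kernel (real i * \<alpha> + (2 * \<alpha> + (2 * \<alpha> + 1))) x)"
  proof
    fix i
    have "real (i + 2) * \<alpha> + (2 * \<alpha> + 1) = real i * \<alpha> + (2 * \<alpha> + (2 * \<alpha> + 1))"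
      by (simp add: algebra_simps)
    then show "?B (i + 2) * ?k (i + 2) - ?A (i + 2) * ?k (i + 2) =
      ?C i * rl_kernel (real i * \<alpha> + (2 * \<alpha> + (2 * \<alpha> + 1))) x"
      by (simp only: C left_diff_distrib)
  qed
  finally have "gamma_series \<alpha> (2 * \<alpha> + (2 * \<alpha> + 1)) ?C x = mean_count lam \<alpha> x - interarrival_cdf lam \<alpha> x"
    by (simp add: gamma_series_def sums_iff)
  moreover have "has_bochner_integral lborel (\<lambda>s. interarrival_density lam \<alpha> s * mean_count lam \<alpha> (x - s))
      (gamma_series \<alpha> (2 * \<alpha> + (2 * \<alpha> + 1)) ?C x)"
    unfolding interarrival_density_eq_gamma_series[OF assms] mean_count_def
    using assms by (intro gamma_series_conv) auto
  ultimately show ?thesis by simp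
qed

section \<open>Iterated convolutions of a positive law\<close>

text \<open>
  The distribution function of the sum of \<open>n\<close> independent variables with law \<open>\<mu>\<close>.  The recursion on
  functions avoids iterated convolutions of measures; it serves both for the renewal epochs and,
  through its complement, for the claim sums.
\<close>

primrec conv_cdf :: "real measure \<Rightarrow> nat \<Rightarrow> real \<Rightarrow> real" where
  "conv_cdf \<mu> 0 x = (if 0 \<le> x then 1 else 0)"
| "conv_cdf \<mu> (Suc n) x = (\<integral>y. conv_cdf \<mu> n (x - y) \<partial>\<mu>)"

lemma (in real_distribution) measurable_conv_cdf [measurable]: "conv_cdf M n \<in> borel_measurable borel"
proof (induction n)
  case 0
  show ?case by (simp add: measurable_If_set)
next
  case (Suc n)
  note [measurable] = Suc
  have "(\<lambda>x. \<integral>y. conv_cdf M n (x - y) \<partial>M) \<in> borel_measurable borel"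
    by (rule borel_measurable_lebesgue_integral) measurable
  then show ?case by simp
qed

lemma (in real_distribution) conv_cdf_Suc_0: "conv_cdf M (Suc 0) = cdf M"
proof
  fix x
  have "conv_cdf M (Suc 0) x = (\<integral>v. indicator {..x} v \<partial>M)"
    unfolding conv_cdf.simps
    by (intro Bochner_Integration.integral_cong) (auto simp: indicator_def)
  then show "conv_cdf M (Suc 0) x = cdf M x" by (simp add: cdf_def)
qed

locale positive_law = real_distribution \<mu> for \<mu> :: "real measure" +
  assumes AE_pos: "AE x in \<mu>. 0 < x"
begin

abbreviation G :: "nat \<Rightarrow> real \<Rightarrow> real" where "G \<equiv> conv_cdf \<mu>"

lemma conv_cdf_bounds: "0 \<le> G n x \<and> G n x \<le> 1"
proof (induction n arbitrary: x)
  case (Suc n)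
  have "0 \<le> (\<integral>y. G n (x - y) \<partial>\<mu>)" using Suc by (intro Bochner_Integration.integral_nonneg) auto
  moreover have "(\<integral>y. G n (x - y) \<partial>\<mu>) \<le> 1"
    using Suc by (intro integral_le_const integrable_const_bound[of _ 1]) auto
  ultimately show ?case by simp
qed simp

lemma conv_cdf_nonneg [simp]: "0 \<le> G n x" and conv_cdf_le_1 [simp]: "G n x \<le> 1"
  using conv_cdf_bounds by auto

lemma integrable_conv_cdf [simp]: "integrable \<mu> (\<lambda>y. G n (x - y))"
  by (intro integrable_const_bound[of _ 1]) auto

lemma conv_cdf_neg: "x < 0 \<Longrightarrow> G n x = 0"
proof (induction n arbitrary: x)
  case (Suc n)
  have "AE y in \<mu>. G n (x - y) = 0" using AE_pos by eventually_elim (use Suc in auto)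
  then show ?case by (simp add: integral_eq_zero_AE)
qed simp

text \<open>
  Chernoff's bound: the Laplace transform of a positive law tends to \<open>0\<close> at infinity, so it can be
  made smaller than \<open>\<theta>\<close> at the cost of a constant depending on \<open>x\<close>.
\<close>

lemma conv_cdf_exponential_bound:
  assumes "0 < \<theta>"
  shows "\<exists>C\<ge>0. \<forall>n. G n x \<le> C * \<theta> ^ n"
proof -
  have "(\<lambda>k. \<integral>y. exp (- (real k * y)) * indicator {0<..} y \<partial>\<mu>) \<longlonglongrightarrow> (\<integral>y. 0 \<partial>\<mu>)"
  proof (rule integral_dominated_convergence[where w = "\<lambda>_. 1"])
    show "AE y in \<mu>. (\<lambda>k. exp (- (real k * y)) * indicator {0<..} y) \<longlonglongrightarrow> 0"
      using AE_pos
    proof eventually_elim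
      case (elim y)
      then show ?case by simp real_asymp
    qed
  qed (auto simp: indicator_def)
  then have "eventually (\<lambda>k. (\<integral>y. exp (- (real k * y)) * indicator {0<..} y \<partial>\<mu>) < \<theta>) sequentially"
    using assms by (intro order_tendstoD) auto
  then obtain k :: nat where k: "(\<integral>y. exp (- (real k * y)) * indicator {0<..} y \<partial>\<mu>) < \<theta>"
    by (auto simp: eventually_sequentially)
  have int: "integrable \<mu> (\<lambda>y. exp (- (real k * y)) * indicator {0<..} y)"
    by (intro integrable_const_bound[of _ 1]) (auto simp: indicator_def)
  have "G n x \<le> exp (real k * x) * \<theta> ^ n" for n x
  proof (induction n arbitrary: x)
    case (Suc n)
    have "G (Suc n) x = (\<integral>y. G n (x - y) \<partial>\<mu>)" by simp
    also have "\<dots> \<le> (\<integral>y. (exp (real k * x) * \<theta> ^ n) * (exp (- (real k * y)) * indicator {0<..} y) \<partial>\<mu>)"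
    proof (intro integral_mono_AE integrable_mult_right int integrable_conv_cdf)
      show "AE y in \<mu>. G n (x - y) \<le> (exp (real k * x) * \<theta> ^ n) * (exp (- (real k * y)) * indicator {0<..} y)"
        using AE_pos
      proof eventually_elim
        case (elim y)
        with Suc[of "x - y"] show ?case by (simp add: right_diff_distrib exp_diff exp_minus field_simps)
      qed
    qed
    also have "\<dots> = (exp (real k * x) * \<theta> ^ n) * (\<integral>y. exp (- (real k * y)) * indicator {0<..} y \<partial>\<mu>)"
      by (rule integral_mult_right_zero)
    also have "\<dots> \<le> (exp (real k * x) * \<theta> ^ n) * \<theta>"
      using k assms by (intro mult_left_mono) auto
    finally show ?case by (simp add: mult_ac)
  qed simp
  then show ?thesis by (intro exI[of _ "exp (real k * x)"]) auto
qed

lemma conv_cdf_weighted_summable: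
  assumes "0 \<le> r"
  shows "summable (\<lambda>n. r ^ n * G n x)"
proof -
  have "0 < 1 / (2 * r + 1)" using assms by simp
  then obtain C where C: "0 \<le> C" "\<And>n. G n x \<le> C * (1 / (2 * r + 1)) ^ n"
    using conv_cdf_exponential_bound by meson
  show ?thesis
  proof (rule summable_comparison_test'[of "\<lambda>n. C * (r / (2 * r + 1)) ^ n" 0])
    show "summable (\<lambda>n. C * (r / (2 * r + 1)) ^ n)"
      using assms by (intro summable_mult summable_geometric) (auto simp: field_simps)
    fix n
    have "r ^ n * G n x \<le> r ^ n * (C * (1 / (2 * r + 1)) ^ n)"
      using C assms by (intro mult_left_mono) auto
    then show "norm (r ^ n * G n x) \<le> C * (r / (2 * r + 1)) ^ n"
      using assms by (simp add: power_divide abs_mult mult_ac)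
  qed
qed

lemma conv_cdf_tendsto_0: "(\<lambda>n. G n x) \<longlonglongrightarrow> 0"
  using summable_LIMSEQ_zero[OF conv_cdf_weighted_summable[of 1 x]] by simp

text \<open>
  Iterating the renewal equation leaves the remainder \<open>H\<close> convolved \<open>n\<close> times with \<open>\<mu>\<close>.  As \<open>H\<close> is bounded
  on \<open>{..t}\<close> and vanishes on the negative half-line, the remainder is at most \<open>C * conv_cdf \<mu> n\<close>, which tends to \<open>0\<close>.
\<close>

lemma renewal_equation_solution:
  fixes H :: "real \<Rightarrow> real"
  assumes meas: "H \<in> borel_measurable borel"
    and neg: "\<And>x. x < 0 \<Longrightarrow> H x = 0"
    and bound: "\<And>x. x \<le> t \<Longrightarrow> \<bar>H x\<bar> \<le> C"
    and renewal: "\<And>x. x \<le> t \<Longrightarrow> H x = cdf \<mu> x + (\<integral>y. H (x - y) \<partial>\<mu>)"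
  shows "(\<lambda>n. G (Suc n) t) sums H t"
proof -
  note [measurable] = meas
  have intH: "integrable \<mu> (\<lambda>y. H (x - y))" if "x \<le> t" for x
  proof (rule integrable_const_bound[of _ C])
    show "AE y in \<mu>. norm (H (x - y)) \<le> C"
      using AE_pos by eventually_elim (use that bound in auto)
  qed simp
  have est: "\<bar>H x - (\<Sum>k<n. G (Suc k) x)\<bar> \<le> C * G n x" if "x \<le> t" for n x
    using that
  proof (induction n arbitrary: x)
    case 0
    then show ?case using neg[of x] bound[of x] by auto
  next
    case (Suc n)
    have "H x - (\<Sum>k<Suc n. G (Suc k) x) =
        (\<integral>y. H (x - y) \<partial>\<mu>) - (\<Sum>k<n. \<integral>y. G (Suc k) (x - y) \<partial>\<mu>)"
      using renewal[OF Suc.prems] conv_cdf_Suc_0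
      by (subst sum.lessThan_Suc_shift) simp
    also have "\<dots> = (\<integral>y. H (x - y) - (\<Sum>k<n. G (Suc k) (x - y)) \<partial>\<mu>)"
      using intH[OF Suc.prems]
      by (subst Bochner_Integration.integral_diff)
         (auto intro!: integrable_sum integrable_conv_cdf simp del: conv_cdf.simps)
    finally have eq: "H x - (\<Sum>k<Suc n. G (Suc k) x) =
        (\<integral>y. H (x - y) - (\<Sum>k<n. G (Suc k) (x - y)) \<partial>\<mu>)" .
    have intG: "integrable \<mu> (\<lambda>y. \<Sum>k<n. G (Suc k) (x - y))"
      by (rule Bochner_Integration.integrable_sum) (rule integrable_conv_cdf)
    have "\<bar>\<integral>y. H (x - y) - (\<Sum>k<n. G (Suc k) (x - y)) \<partial>\<mu>\<bar> \<le> (\<integral>y. \<bar>H (x - y) - (\<Sum>k<n. G (Suc k) (x - y))\<bar> \<partial>\<mu>)"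
      by (rule integral_abs_bound)
    also have "\<dots> \<le> (\<integral>y. C * G n (x - y) \<partial>\<mu>)"
    proof (intro integral_mono_AE integrable_abs Bochner_Integration.integrable_diff intH intG
        integrable_mult_right integrable_conv_cdf Suc.prems)
      show "AE y in \<mu>. \<bar>H (x - y) - (\<Sum>k<n. G (Suc k) (x - y))\<bar> \<le> C * G n (x - y)"
        using AE_pos by eventually_elim (intro Suc.IH, use Suc.prems in simp)
    qed
    also have "\<dots> = C * G (Suc n) x" by simp
    finally show ?case unfolding eq .
  qed
  have "(\<lambda>n. H t - (\<Sum>k<n. G (Suc k) t)) \<longlonglongrightarrow> 0"
  proof (rule Lim_null_comparison)
    show "eventually (\<lambda>n. norm (H t - (\<Sum>k<n. G (Suc k) t)) \<le> C * G n t) sequentially"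
      using est[of t] by simp
    show "(\<lambda>n. C * G n t) \<longlonglongrightarrow> 0"
      using tendsto_mult_right_zero[OF conv_cdf_tendsto_0] by simp
  qed
  then have "(\<lambda>n. H t - (H t - (\<Sum>k<n. G (Suc k) t))) \<longlonglongrightarrow> H t - 0"
    by (intro tendsto_diff tendsto_const)
  then show ?thesis by (simp add: sums_def)
qed

end

text \<open>
  This is what connects the analytic recursion with random variables.
\<close>

lemma (in prob_space) indep_sum_le:
  fixes X :: "nat \<Rightarrow> 'a \<Rightarrow> real"
  assumes indep: "indep_vars (\<lambda>_. borel) X {1..}"
    and law: "\<And>i. 1 \<le> i \<Longrightarrow> distr M borel (X i) = \<mu>"
  shows "prob {\<omega> \<in> space M. (\<Sum>i=1..n. X i \<omega>) \<le> x} = conv_cdf \<mu> n x"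
proof (induction n arbitrary: x)
  case 0
  then show ?case by (simp add: prob_space)
next
  case (Suc n)
  have rv [measurable]: "X i \<in> borel_measurable M" if "1 \<le> i" for i
    using indep that by (auto simp: indep_vars_def2)
  define S where "S \<omega> = (\<Sum>i=1..n. X i \<omega>)" for \<omega>
  have [measurable]: "S \<in> borel_measurable M"
    unfolding S_def by (intro borel_measurable_sum) auto
  have ind: "indep_var borel (X (Suc n)) borel S"
    unfolding S_def
    using indep_vars_sum[of "{1..n}" "Suc n" X] indep_vars_subset[OF indep] by auto
  interpret mu: real_distribution \<mu>
    using real_distribution_distr[of "X 1"] law[of 1] by auto
  interpret D: prob_space "distr M borel S" by (intro prob_space_distr) simp
  have "prob {\<omega> \<in> space M. (\<Sum>i=1..Suc n. X i \<omega>) \<le> x} = prob {\<omega> \<in> space M. X (Suc n) \<omega> + S \<omega> \<le> x}"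
    by (simp add: S_def add.commute)
  also have "ennreal \<dots> = emeasure (distr M borel (\<lambda>\<omega>. X (Suc n) \<omega> + S \<omega>)) {..x}"
    by (subst emeasure_distr) (auto simp: emeasure_eq_measure intro!: arg_cong[where f = prob])
  also have "distr M borel (\<lambda>\<omega>. X (Suc n) \<omega> + S \<omega>) = (\<mu> \<star> distr M borel S)"
    using sum_indep_random_variable[OF ind] law[of "Suc n"] by simp
  also have "emeasure (\<mu> \<star> distr M borel S) {..x} = (\<integral>\<^sup>+y. emeasure (distr M borel S) {a. a + y \<in> {..x}} \<partial>\<mu>)"
    using mu.finite_measure_axioms D.finite_measure_axioms
    by (intro convolution_emeasure) auto
  also have "\<dots> = (\<integral>\<^sup>+y. ennreal (conv_cdf \<mu> n (x - y)) \<partial>\<mu>)"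
  proof (intro nn_integral_cong)
    fix y
    have "emeasure (distr M borel S) {a. a + y \<in> {..x}} = emeasure M {\<omega> \<in> space M. S \<omega> \<le> x - y}"
      by (subst emeasure_distr) (auto intro!: arg_cong[where f = "emeasure M"])
    then show "emeasure (distr M borel S) {a. a + y \<in> {..x}} = ennreal (conv_cdf \<mu> n (x - y))"
      using Suc[of "x - y"] by (simp add: emeasure_eq_measure S_def)
  qed
  finally have eq: "ennreal (prob {\<omega> \<in> space M. (\<Sum>i=1..Suc n. X i \<omega>) \<le> x}) = (\<integral>\<^sup>+y. ennreal (conv_cdf \<mu> n (x - y)) \<partial>\<mu>)" .
  have "(\<integral>y. conv_cdf \<mu> n (x - y) \<partial>\<mu>) = enn2real (\<integral>\<^sup>+y. ennreal (conv_cdf \<mu> n (x - y)) \<partial>\<mu>)"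
    by (intro integral_eq_nn_integral) (auto simp: Suc[symmetric])
  then show ?case by (simp add: eq[symmetric])
qed

section \<open>Tails of sums under a subexponential law\<close>

lemma (in real_distribution) cdf_convolution_self: "cdf (M \<star> M) x = conv_cdf M 2 x"
proof -
  have [measurable]: "cdf M \<in> borel_measurable borel"
    using measurable_conv_cdf[of "Suc 0"] unfolding conv_cdf_Suc_0 .
  have "emeasure (M \<star> M) {..x} = (\<integral>\<^sup>+y. emeasure M {a. a + y \<in> {..x}} \<partial>M)"
    using finite_measure_axioms by (intro convolution_emeasure) auto
  also have "\<dots> = (\<integral>\<^sup>+y. ennreal (cdf M (x - y)) \<partial>M)"
  proof (intro nn_integral_cong)
    fix y
    have "{a. a + y \<in> {..x}} = {..x - y}" by auto
    then show "emeasure M {a. a + y \<in> {..x}} = ennreal (cdf M (x - y))"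
      by (simp add: emeasure_eq_measure cdf_def)
  qed
  finally have eq: "emeasure (M \<star> M) {..x} = (\<integral>\<^sup>+y. ennreal (cdf M (x - y)) \<partial>M)" .
  have "conv_cdf M 2 x = (\<integral>y. cdf M (x - y) \<partial>M)"
    unfolding numeral_2_eq_2 conv_cdf.simps(2)[of _ "Suc 0"] conv_cdf_Suc_0 ..
  also have "\<dots> = enn2real (\<integral>\<^sup>+y. ennreal (cdf M (x - y)) \<partial>M)"
    by (intro integral_eq_nn_integral) (auto simp: cdf_nonneg)
  finally show ?thesis
    by (simp only: eq[symmetric]) (simp add: cdf_def measure_def)
qed

text \<open>
  Subexponentiality in terms of \<open>conv_cdf\<close>; by \<open>cdf_convolution_self\<close> it is the usual condition.
\<close>

locale subexponential_law = positive_law \<mu> for \<mu> :: "real measure" +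
  assumes subexp: "((\<lambda>x. (1 - conv_cdf \<mu> 2 x) / (1 - cdf \<mu> x)) \<longlongrightarrow> 2) at_top"
begin

definition sum_tail :: "nat \<Rightarrow> real \<Rightarrow> real" where "sum_tail n x = 1 - G n x"

lemma sum_tail_measurable [measurable]: "sum_tail n \<in> borel_measurable borel"
  unfolding sum_tail_def by measurable

lemma sum_tail_bounds [simp]: "0 \<le> sum_tail n x" "sum_tail n x \<le> 1" by (simp_all add: sum_tail_def)

definition tail :: "real \<Rightarrow> real" where "tail x = 1 - cdf \<mu> x"

lemma sum_tail_Suc_0: "sum_tail (Suc 0) x = tail x" by (simp only: sum_tail_def tail_def conv_cdf_Suc_0)

lemma sum_tail_neg: "x < 0 \<Longrightarrow> sum_tail n x = 1" by (simp add: sum_tail_def conv_cdf_neg)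

lemma sum_tail_integrable [simp]: "integrable \<mu> (\<lambda>y. sum_tail n (x - y))"
  unfolding sum_tail_def by simp

lemma sum_tail_Suc: "sum_tail (Suc n) x = (\<integral>y. sum_tail n (x - y) \<partial>\<mu>)"
  unfolding sum_tail_def by (simp add: prob_space[unfolded space_eq_univ])

lemma sum_tail_2: "sum_tail 2 x = (\<integral>y. tail (x - y) \<partial>\<mu>)"
  unfolding numeral_2_eq_2 sum_tail_Suc[of "Suc 0"] sum_tail_Suc_0 ..

lemma tail_measurable [measurable]: "tail \<in> borel_measurable borel"
  using sum_tail_measurable[of "Suc 0"] unfolding sum_tail_Suc_0 .

lemma tail_bounds [simp]: "0 \<le> tail x" "tail x \<le> 1"
  using sum_tail_bounds[of "Suc 0" x] by (simp_all only: sum_tail_Suc_0)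

lemma tail_neg: "x < 0 \<Longrightarrow> tail x = 1"
  using sum_tail_neg[of x "Suc 0"] by (simp only: sum_tail_Suc_0)

lemma tail_integrable [simp]: "integrable \<mu> (\<lambda>y. tail (x - y))"
  using sum_tail_integrable[of "Suc 0" x] by (simp only: sum_tail_Suc_0)

lemma tail_antimono: "x \<le> y \<Longrightarrow> tail y \<le> tail x"
  unfolding tail_def using cdf_nondecreasing[of x y] by simp

lemma ratio_2: "((\<lambda>x. sum_tail 2 x / tail x) \<longlongrightarrow> 2) at_top"
  unfolding tail_def sum_tail_def by (rule subexp)

text \<open>
  If the tail vanished somewhere, the ratio would be \<open>0\<close> from there on by the convention for
  division by \<open>0\<close>, which contradicts its limit \<open>2\<close>.
\<close>

lemma tail_pos: "0 < tail x"
proof (rule ccontr)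
  assume "\<not> 0 < tail x"
  then have "tail x = 0" using tail_bounds(1)[of x] by linarith
  then have "tail y = 0" if "x \<le> y" for y
    using tail_antimono[OF that] tail_bounds(1)[of y] by linarith
  then have "eventually (\<lambda>y. sum_tail 2 y / tail y = 0) at_top"
    by (auto simp: eventually_at_top_linorder)
  then have "((\<lambda>x. sum_tail 2 x / tail x) \<longlongrightarrow> 0) at_top"
    by (rule tendsto_eventually)
  with ratio_2 show False
    using tendsto_unique[of at_top "\<lambda>x. sum_tail 2 x / tail x" 2 0] by simp
qed

text \<open>
  Split the two-fold tail according to whether the first summand lies in \<open>{..y}\<close>, \<open>{y<..x}\<close> or \<open>{x<..}\<close>.
  The first and the last part already contribute \<open>1 + F y\<close> to the ratio, whose limit is \<open>2\<close>, so
  the middle part contributes at most \<open>1 - F y\<close> in the limit.  Its mass tends to \<open>1 - F y\<close>, and on it the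
  integrand is at least \<open>tail (x - y)\<close>.
\<close>

lemma long_tailed:
  assumes "0 \<le> y"
  shows "((\<lambda>x. tail (x - y) / tail x) \<longlongrightarrow> 1) at_top"
proof (rule tendsto_sandwich[where f = "\<lambda>_. 1"])
  let ?F = "cdf \<mu>"
  have Fy: "?F y < 1" using tail_pos[of y] by (simp add: tail_def)
  have Ftop: "(?F \<longlongrightarrow> 1) at_top" by (rule cdf_lim_at_top_prob)
  then have "eventually (\<lambda>x. ?F y < ?F x) at_top" using Fy by (rule order_tendstoD)
  then show "eventually (\<lambda>x. tail (x - y) / tail x \<le> (sum_tail 2 x / tail x - 1 - ?F y) / (?F x - ?F y)) at_top"
    using eventually_ge_at_top[of y]
  proof eventually_elim
    case (elim x)
    have "tail x * ?F y + tail (x - y) * (?F x - ?F y) + tail x =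
      (\<integral>v. tail x * indicator {..y} v + tail (x - y) * indicator {y<..x} v + indicator {x<..} v \<partial>\<mu>)"
    proof -
      have "measure \<mu> {y<..x} = ?F x - ?F y"
        using elim cdf_diff_eq[of y x] by (cases "y = x") auto
      moreover have "measure \<mu> {x<..} = tail x"
        using prob_compl[of "{..x}"] by (simp add: tail_def cdf_def Compl_eq_Diff_UNIV[symmetric])
      ultimately show ?thesis
        by (simp add: cdf_def2 less_top[symmetric])
    qed
    also have "\<dots> \<le> sum_tail 2 x"
      unfolding sum_tail_2
    proof (intro integral_mono_AE)
      show "AE v in \<mu>. tail x * indicator {..y} v + tail (x - y) * indicator {y<..x} v + indicator {x<..} v \<le> tail (x - v)"
        using AE_pos
      proof eventually_elim
        case (elim v)
        then consider "v \<le> y" | "y < v" "v \<le> x" | "x < v" by linarith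
        then show ?case
          using \<open>y \<le> x\<close> elim tail_antimono[of "x - v" x] tail_antimono[of "x - v" "x - y"] tail_neg[of "x - v"]
          by cases (auto)
      qed
      show "integrable \<mu> (\<lambda>v. tail x * indicator {..y} v + tail (x - y) * indicator {y<..x} v + indicator {x<..} v)"
        by (simp add: less_top[symmetric])
    qed simp
    finally have "tail (x - y) * (?F x - ?F y) \<le> sum_tail 2 x - tail x - tail x * ?F y" by simp
    also have "\<dots> = tail x * (sum_tail 2 x / tail x - 1 - ?F y)"
      using tail_pos[of x] by (simp add: field_simps)
    finally show ?case
      using tail_pos[of x] elim by (simp add: field_simps)
  qed
  have "((\<lambda>x. (sum_tail 2 x / tail x - 1 - ?F y) / (?F x - ?F y)) \<longlongrightarrow> (2 - 1 - ?F y) / (1 - ?F y)) at_top"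
    using Fy by (intro tendsto_intros ratio_2 Ftop) auto
  then show "((\<lambda>x. (sum_tail 2 x / tail x - 1 - ?F y) / (?F x - ?F y)) \<longlongrightarrow> 1) at_top"
    using Fy by simp
  show "eventually (\<lambda>x. 1 \<le> tail (x - y) / tail x) at_top"
    using tail_pos tail_antimono assms by (intro always_eventually allI) simp
qed (rule tendsto_const)

text \<open>
  The ratio of the two-fold tail to the tail is bounded by some \<open>K\<close>, and integrating the bound for
  \<open>n\<close> summands against \<open>\<mu>\<close> produces exactly this ratio once more.
\<close>

lemma tail_power_bound: "\<exists>K\<ge>0. \<forall>n x. sum_tail n x \<le> K ^ n * tail x"
proof -
  have "eventually (\<lambda>x. sum_tail 2 x / tail x < 3) at_top"
    using ratio_2 by (rule order_tendstoD) simp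
  then obtain x0 where x0: "\<And>x. x0 \<le> x \<Longrightarrow> sum_tail 2 x / tail x < 3"
    by (auto simp: eventually_at_top_linorder)
  define K where "K = max 3 (1 / tail x0)"
  have two: "sum_tail 2 x \<le> K * tail x" for x
  proof (cases "x0 \<le> x")
    case True
    then have "sum_tail 2 x \<le> 3 * tail x" using x0[of x] tail_pos[of x] by (simp add: field_simps)
    also have "\<dots> \<le> K * tail x" by (intro mult_right_mono) (auto simp: K_def)
    finally show ?thesis .
  next
    case False
    have "sum_tail 2 x \<le> 1" by simp
    also have "1 \<le> (1 / tail x0) * tail x"
      using tail_antimono[of x x0] False tail_pos[of x0] by (simp add: field_simps)
    also have "\<dots> \<le> K * tail x" by (intro mult_right_mono) (auto simp: K_def)
    finally show ?thesis .
  qed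
  have K: "0 \<le> K" by (simp add: K_def)
  have "sum_tail n x \<le> K ^ n * tail x" for n x
  proof (induction n arbitrary: x)
    case 0
    then show ?case using tail_neg[of x] by (cases "x < 0") (auto simp: sum_tail_def)
  next
    case (Suc n)
    have "sum_tail (Suc n) x \<le> (\<integral>y. K ^ n * tail (x - y) \<partial>\<mu>)"
      unfolding sum_tail_Suc by (intro integral_mono Suc sum_tail_integrable integrable_mult_right tail_integrable)
    also have "\<dots> = K ^ n * sum_tail 2 x" unfolding sum_tail_2 by simp
    also have "\<dots> \<le> K ^ n * (K * tail x)" using K by (intro mult_left_mono two) auto
    finally show ?case by (simp add: mult_ac)
  qed
  with K show ?thesis by blast
qed

text \<open>
  Induction on \<open>n\<close>.  Replacing the \<open>n\<close>-fold tail by \<open>n\<close> times the tail in the recursion gives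
  \<open>n * sum_tail 2 + (1 - n) * tail\<close>, which has the right asymptotics.  The error \<open>J\<close> of this replacement is
  negligible: where \<open>x - v\<close> is large it is small relative to the two-fold tail, and
  the remaining \<open>v\<close> lie in an interval \<open>{x - u0<..x}\<close> of fixed length, whose mass is negligible by
  \<open>long_tailed\<close>.
\<close>

lemma tail_ratio: "((\<lambda>x. sum_tail n x / tail x) \<longlongrightarrow> real n) at_top"
proof (induction n)
  case 0
  have "eventually (\<lambda>x. sum_tail 0 x / tail x = 0) at_top"
    using eventually_ge_at_top[of 0] by eventually_elim (simp add: sum_tail_def)
  then show ?case by (simp add: tendsto_eventually)
next
  case (Suc n)
  define D where "D u = sum_tail n u - real n * tail u" for u
  have [measurable]: "D \<in> borel_measurable borel" unfolding D_def by measurable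
  have Dle: "\<bar>D u\<bar> \<le> real n + 1" for u
  proof -
    have "\<bar>D u\<bar> \<le> sum_tail n u + real n * tail u" unfolding D_def by (rule order.trans[OF abs_triangle_ineq4]) (simp add: abs_mult)
    also have "\<dots> \<le> 1 + real n * 1" by (intro add_mono mult_left_mono) auto
    finally show ?thesis by simp
  qed
  define J where "J x = (\<integral>v. D (x - v) * indicator {..x} v \<partial>\<mu>)" for x
  have intJ: "integrable \<mu> (\<lambda>v. D (x - v) * indicator {..x} v)" for x
    by (rule integrable_const_bound[of _ "real n + 1"]) (use Dle in \<open>auto simp: indicator_def\<close>)
  have step: "sum_tail (Suc n) x = real n * sum_tail 2 x + (1 - real n) * tail x + J x" for x
  proof -
    have "sum_tail (Suc n) x - real n * sum_tail 2 x = (\<integral>v. D (x - v) \<partial>\<mu>)"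
      unfolding sum_tail_Suc sum_tail_2 D_def by simp
    also have "\<dots> = (\<integral>v. D (x - v) * indicator {..x} v + (1 - real n) * indicator {x<..} v \<partial>\<mu>)"
      by (intro Bochner_Integration.integral_cong refl)
         (auto simp: indicator_def D_def sum_tail_neg tail_neg)
    also have "\<dots> = J x + (1 - real n) * measure \<mu> {x<..}"
      using intJ unfolding J_def by (simp add: less_top[symmetric])
    also have "measure \<mu> {x<..} = tail x"
      using prob_compl[of "{..x}"] by (simp add: tail_def cdf_def Compl_eq_Diff_UNIV[symmetric])
    finally show ?thesis by simp
  qed
  obtain K where K: "0 \<le> K" "\<And>n x. sum_tail n x \<le> K ^ n * tail x" using tail_power_bound by blast
  have "((\<lambda>x. J x / tail x) \<longlongrightarrow> 0) at_top"
  proof (rule tendstoI)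
    fix e :: real assume e: "0 < e"
    \<comment> \<open>\<open>K\<^sup>2\<close> bounds the ratio of the two-fold tail to the tail.\<close>
    define d where "d = e / (2 * (K\<^sup>2 + 1))"
    have d: "0 < d" using e by (simp add: d_def add_nonneg_pos)
    have dK: "d * K\<^sup>2 < e / 2"
    proof -
      have "d * (K\<^sup>2 + 1) = e / 2" using add_nonneg_pos[of "K\<^sup>2" 1] by (simp add: d_def field_simps)
      then show ?thesis using d by (simp add: algebra_simps)
    qed
    have "((\<lambda>x. sum_tail n x / tail x - real n) \<longlongrightarrow> real n - real n) at_top"
      by (intro tendsto_diff Suc tendsto_const)
    then have "eventually (\<lambda>x. dist (sum_tail n x / tail x - real n) 0 < d) at_top"
      using d by (intro tendstoD) simp_all
    then obtain u0' where u0': "\<And>u. u0' \<le> u \<Longrightarrow> \<bar>sum_tail n u / tail u - real n\<bar> < d"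
      by (auto simp: eventually_at_top_linorder)
    define u0 where "u0 = max 0 u0'"
    have Dsmall: "\<bar>D u\<bar> \<le> d * tail u" if "u0 \<le> u" for u
    proof -
      have "D u = (sum_tail n u / tail u - real n) * tail u"
        using tail_pos[of u] by (simp add: D_def field_simps)
      then have "\<bar>D u\<bar> = \<bar>sum_tail n u / tail u - real n\<bar> * tail u" by (simp add: abs_mult)
      also have "\<dots> \<le> d * tail u"
        using u0'[of u] that by (intro mult_right_mono) (auto simp: u0_def)
      finally show ?thesis .
    qed
    have Jle: "\<bar>J x\<bar> \<le> d * sum_tail 2 x + (real n + 1) * (tail (x - u0) - tail x)" for x
    proof -
      have "\<bar>J x\<bar> \<le> (\<integral>v. \<bar>D (x - v) * indicator {..x} v\<bar> \<partial>\<mu>)"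
        unfolding J_def by (rule integral_abs_bound)
      also have "\<dots> \<le> (\<integral>v. d * tail (x - v) + (real n + 1) * indicator {x - u0<..x} v \<partial>\<mu>)"
      proof (intro integral_mono integrable_abs intJ)
        show "integrable \<mu> (\<lambda>v. d * tail (x - v) + (real n + 1) * indicator {x - u0<..x} v)"
          by (simp add: less_top[symmetric])
        fix v
        consider "v \<le> x - u0" | "x - u0 < v" "v \<le> x" | "x < v" by linarith
        then show "\<bar>D (x - v) * indicator {..x} v\<bar> \<le> d * tail (x - v) + (real n + 1) * indicator {x - u0<..x} v"
        proof cases
          case 1
          then have "\<bar>D (x - v)\<bar> \<le> d * tail (x - v)" by (intro Dsmall) simp
          with 1 d show ?thesis by (auto simp: indicator_def abs_mult)
        next
          case 2
          have "\<bar>D (x - v)\<bar> \<le> real n + 1" "0 \<le> d * tail (x - v)" using Dle d by auto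
          with 2 show ?thesis by (simp add: abs_mult)
        next
          case 3
          with d show ?thesis by simp
        qed
      qed
      also have "\<dots> = d * sum_tail 2 x + (real n + 1) * measure \<mu> {x - u0<..x}"
        unfolding sum_tail_2 by (simp add: less_top[symmetric])
      also have "measure \<mu> {x - u0<..x} = tail (x - u0) - tail x"
      proof (cases "u0 = 0")
        case False
        then show ?thesis using cdf_diff_eq[of "x - u0" x] by (simp add: tail_def u0_def)
      qed simp
      finally show ?thesis .
    qed
    have "((\<lambda>x. (real n + 1) * (tail (x - u0) / tail x - 1)) \<longlongrightarrow> (real n + 1) * (1 - 1)) at_top"
      by (intro tendsto_mult tendsto_diff tendsto_const long_tailed) (simp add: u0_def)
    then have "eventually (\<lambda>x. (real n + 1) * (tail (x - u0) / tail x - 1) < e / 2) at_top"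
      using e by (intro order_tendstoD) auto
    then show "eventually (\<lambda>x. dist (J x / tail x) 0 < e) at_top"
    proof eventually_elim
      case (elim x)
      note p = tail_pos[of x]
      have "\<bar>J x / tail x\<bar> = \<bar>J x\<bar> / tail x" by (simp add: abs_divide)
      also have "\<dots> \<le> (d * (K\<^sup>2 * tail x) + (real n + 1) * (tail (x - u0) - tail x)) / tail x"
        using p d by (intro divide_right_mono order.trans[OF Jle] add_mono mult_left_mono K) auto
      also have "\<dots> = d * K\<^sup>2 + (real n + 1) * (tail (x - u0) / tail x - 1)"
        using p by (simp add: field_simps)
      also have "\<dots> < e" using add_strict_mono[OF dK elim] by simp
      finally show ?case by (simp add: dist_real_def)
    qed
  qed
  then have "((\<lambda>x. real n * (sum_tail 2 x / tail x) + (1 - real n) + J x / tail x) \<longlongrightarrow> real n * 2 + (1 - real n) + 0) at_top"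
    by (intro tendsto_intros ratio_2)
  also have "(\<lambda>x. real n * (sum_tail 2 x / tail x) + (1 - real n) + J x / tail x) = (\<lambda>x. sum_tail (Suc n) x / tail x)"
  proof
    fix x show "real n * (sum_tail 2 x / tail x) + (1 - real n) + J x / tail x = sum_tail (Suc n) x / tail x"
      unfolding step using tail_pos[of x] by (simp add: field_simps)
  qed
  finally show ?case by (simp add: add.commute)
qed

text \<open>
  Tannery's theorem with the dominating series \<open>p n * K ^ n\<close>.
\<close>

lemma random_sum_tail:
  fixes p :: "nat \<Rightarrow> real"
  assumes p: "\<And>n. 0 \<le> p n" "\<And>r. 0 \<le> r \<Longrightarrow> summable (\<lambda>n. p n * r ^ n)"
  shows "((\<lambda>x. (\<Sum>n. p n * sum_tail n x) / tail x) \<longlongrightarrow> (\<Sum>n. p n * real n)) at_top"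
proof -
  obtain K where K: "0 \<le> K" "\<And>n x. sum_tail n x \<le> K ^ n * tail x" using tail_power_bound by blast
  have b: "norm (p n * (sum_tail n x / tail x)) \<le> p n * K ^ n" for n x
    using p(1)[of n] K(2)[of n x] tail_pos[of x]
    by (auto simp: abs_mult field_simps intro!: mult_left_mono)
  have "((\<lambda>x. \<Sum>n. p n * (sum_tail n x / tail x)) \<longlongrightarrow> (\<Sum>n. p n * real n)) at_top"
  proof (rule tannerys_theorem[THEN conjunct2, THEN conjunct2])
    show "((\<lambda>x. p n * (sum_tail n x / tail x)) \<longlongrightarrow> p n * real n) at_top" for n
      by (intro tendsto_intros tail_ratio)
    show "\<forall>\<^sub>F (n, x) in sequentially \<times>\<^sub>F at_top. norm (p n * (sum_tail n x / tail x)) \<le> p n * K ^ n"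
      using b by (intro always_eventually) auto
  qed (use p K in auto)
  moreover have "(\<Sum>n. p n * (sum_tail n x / tail x)) = (\<Sum>n. p n * sum_tail n x) / tail x" for x
  proof -
    have "summable (\<lambda>n. p n * sum_tail n x)"
      by (rule summable_comparison_test'[OF p(2)[of 1], of 0])
         (use p(1) in \<open>auto simp: abs_mult intro!: mult_left_le\<close>)
    then show ?thesis using suminf_divide[of "\<lambda>n. p n * sum_tail n x" "tail x"] by simp
  qed
  ultimately show ?thesis by simp
qed

end

section \<open>Renewal counting along a path\<close>

definition renewal_epoch :: "(nat \<Rightarrow> real) \<Rightarrow> nat \<Rightarrow> real" where
  "renewal_epoch w n = (\<Sum>i=1..n. w i)"

definition renewals_until :: "(nat \<Rightarrow> real) \<Rightarrow> real \<Rightarrow> nat set" where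
  "renewals_until w t = {n. 1 \<le> n \<and> renewal_epoch w n \<le> t}"

lemma renewal_epoch_mono:
  assumes "\<And>i. 1 \<le> i \<Longrightarrow> 0 < w i" "m \<le> n"
  shows "renewal_epoch w m \<le> renewal_epoch w n"
  unfolding renewal_epoch_def using assms by (intro sum_mono2) (auto intro: less_imp_le)

lemma renewals_until_mono: "s \<le> t \<Longrightarrow> renewals_until w s \<subseteq> renewals_until w t"
  by (auto simp: renewals_until_def)

lemma renewals_until_atLeastAtMost:
  assumes "\<And>i. 1 \<le> i \<Longrightarrow> 0 < w i" "renewal_epoch w n \<le> t" "t < renewal_epoch w (Suc n)"
  shows "renewals_until w t = {1..n}"
proof -
  have "m \<le> n" if "renewal_epoch w m \<le> t" for m
  proof (rule ccontr)
    assume "\<not> m \<le> n"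
    then have "renewal_epoch w (Suc n) \<le> renewal_epoch w m"
      using assms(1) by (intro renewal_epoch_mono) auto
    with that assms(3) show False by simp
  qed
  moreover have "renewal_epoch w m \<le> t" if "m \<le> n" for m
    using renewal_epoch_mono[of w m n] assms that by force
  ultimately show ?thesis by (auto simp: renewals_until_def)
qed

lemma finite_renewals_until:
  assumes "\<And>i. 1 \<le> i \<Longrightarrow> 0 < w i" "0 \<le> t" "finite (renewals_until w t)"
  obtains n where "renewal_epoch w n \<le> t" "t < renewal_epoch w (Suc n)"
proof -
  obtain m where m: "m \<ge> 1" "m \<notin> renewals_until w t"
    using ex_new_if_finite[of "insert 0 (renewals_until w t)"] assms(3)
    by (auto simp: Suc_le_eq)
  then have ex: "t < renewal_epoch w m" by (auto simp: renewals_until_def)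
  define k where "k = (LEAST m. t < renewal_epoch w m)"
  have k: "t < renewal_epoch w k" unfolding k_def using ex by (rule LeastI)
  then have "k \<noteq> 0" using assms(2) by (intro notI) (simp add: renewal_epoch_def)
  then obtain n where n: "k = Suc n" by (cases k) auto
  have "\<not> t < renewal_epoch w n" using not_less_Least[of n "\<lambda>m. t < renewal_epoch w m"] n by (simp add: k_def)
  with k n show ?thesis by (intro that[of n]) auto
qed

lemma card_renewals_until_iff:
  assumes "\<And>i. 1 \<le> i \<Longrightarrow> 0 < w i" "0 \<le> t" "1 \<le> n"
  shows "card (renewals_until w t) = n \<longleftrightarrow> renewal_epoch w n \<le> t \<and> t < renewal_epoch w (Suc n)"
proof
  assume c: "card (renewals_until w t) = n"
  then have "finite (renewals_until w t)" using assms(3) by (intro card_ge_0_finite) auto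
  then obtain k where k: "renewal_epoch w k \<le> t" "t < renewal_epoch w (Suc k)"
    using finite_renewals_until[of w t] assms by metis
  then have "k = n" using renewals_until_atLeastAtMost[of w k t] assms(1) c by auto
  with k show "renewal_epoch w n \<le> t \<and> t < renewal_epoch w (Suc n)" by simp
qed (use renewals_until_atLeastAtMost[of w n t] assms(1) in auto)

text \<open>
  This includes the paths on which the renewals accumulate: from the accumulation point on,
  infinitely many renewals have occurred and the cardinality is constantly \<open>0\<close>.  Right-continuity on
  every path makes the ruin event measurable without completing the measure.
\<close>

lemma card_renewals_until_right_const:
  assumes "\<And>i. 1 \<le> i \<Longrightarrow> 0 < w i" "0 \<le> t"
  shows "\<exists>d>0. \<forall>u. t \<le> u \<and> u < t + d \<longrightarrow> card (renewals_until w u) = card (renewals_until w t)"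
proof (cases "finite (renewals_until w t)")
  case True
  then obtain k where k: "renewal_epoch w k \<le> t" "t < renewal_epoch w (Suc k)"
    using finite_renewals_until[of w t] assms by metis
  have "renewals_until w u = {1..k}" if "t \<le> u" "u < renewal_epoch w (Suc k)" for u
    using assms(1) k that by (intro renewals_until_atLeastAtMost) auto
  with k show ?thesis by (intro exI[of _ "renewal_epoch w (Suc k) - t"]) auto
next
  case False
  then have "infinite (renewals_until w u)" if "t \<le> u" for u
    using renewals_until_mono[OF that] finite_subset by blast
  with False show ?thesis by (intro exI[of _ 1]) auto
qed

section \<open>Ruin along a path\<close>

text \<open>
  Between claims the capital is continuous and the counting function is constant to the right, so
  a time of negative capital may be moved to a rational one slightly later.  The right-hand
  side is a countable combination of events at fixed times.
\<close>

lemma ruin_time_le_iff: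
  fixes N :: "real \<Rightarrow> 'a \<Rightarrow> nat" and t z c :: real
  assumes c: "0 < c" and t: "0 < t"
    and rc: "\<And>s. 0 \<le> s \<Longrightarrow> \<exists>d>0. \<forall>u. s \<le> u \<and> u < s + d \<longrightarrow> N u \<omega> = N s \<omega>"
  shows "ruin_time (risk_process c N X z) \<omega> \<le> ereal t \<longleftrightarrow>
    (\<forall>k::nat. \<exists>q\<in>\<rat>. 0 < q \<and> q < t + inverse (real (Suc k)) \<and> risk_process c N X z q \<omega> < 0)"
proof
  let ?R = "risk_process c N X z"
  assume le: "ruin_time ?R \<omega> \<le> ereal t"
  show "\<forall>k::nat. \<exists>q\<in>\<rat>. 0 < q \<and> q < t + inverse (real (Suc k)) \<and> ?R q \<omega> < 0"
  proof
    fix k :: nat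
    have "ruin_time ?R \<omega> < ereal (t + inverse (real (Suc k)))"
      using le by (rule order.strict_trans1) simp
    then obtain s where s: "0 < s" "?R s \<omega> < 0" "s < t + inverse (real (Suc k))"
      unfolding ruin_time_def Inf_less_iff by auto
    obtain d where d: "0 < d" "\<And>u. s \<le> u \<Longrightarrow> u < s + d \<Longrightarrow> N u \<omega> = N s \<omega>"
      using rc[of s] s by auto
    define e where "e = Min {d, - ?R s \<omega> / c, t + inverse (real (Suc k)) - s}"
    have e: "0 < e" "e \<le> d" "e \<le> - ?R s \<omega> / c" "e \<le> t + inverse (real (Suc k)) - s"
      using d(1) s c by (auto simp: e_def divide_less_0_iff)
    obtain q where q: "q \<in> \<rat>" "s < q" "q < s + e"
      using Rats_dense_in_real[of s "s + e"] e by auto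
    have "?R q \<omega> = ?R s \<omega> + c * (q - s)"
      using d(2)[of q] q e by (simp add: risk_process_def algebra_simps)
    also have "c * (q - s) < c * (- ?R s \<omega> / c)"
      using q e c by (intro mult_strict_left_mono) auto
    finally have "?R q \<omega> < 0" using c by simp
    with q e s show "\<exists>q\<in>\<rat>. 0 < q \<and> q < t + inverse (real (Suc k)) \<and> ?R q \<omega> < 0"
      by (intro bexI[of _ q]) auto
  qed
next
  let ?R = "risk_process c N X z"
  assume ex: "\<forall>k::nat. \<exists>q\<in>\<rat>. 0 < q \<and> q < t + inverse (real (Suc k)) \<and> ?R q \<omega> < 0"
  show "ruin_time ?R \<omega> \<le> ereal t"
  proof (rule ereal_le_epsilon2)
    fix e :: real assume "0 < e"
    then obtain k where k: "inverse (real (Suc k)) < e" using reals_Archimedean by blast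
    obtain q where q: "0 < q" "q < t + inverse (real (Suc k))" "?R q \<omega> < 0" using ex by blast
    have "ruin_time ?R \<omega> \<le> ereal q"
      unfolding ruin_time_def using q by (intro Inf_lower) auto
    also have "\<dots> \<le> ereal t + ereal e" using q k by simp
    finally show "ruin_time ?R \<omega> \<le> ereal t + ereal e" .
  qed
qed

text \<open>
  The ruin time is an infimum that need not be attained, so a ruin time of at most \<open>t\<close>
  only yields negative capital at times before \<open>t + d\<close>; there the count is still at most \<open>N t \<omega>\<close>.
\<close>

lemma ruin_time_le_imp_claims_exceed:
  fixes N :: "real \<Rightarrow> 'a \<Rightarrow> nat" and t z c :: real
  assumes c: "0 < c" and t: "0 < t"
    and rc: "\<exists>d>0. \<forall>u. t \<le> u \<and> u < t + d \<longrightarrow> N u \<omega> = N t \<omega>"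
    and mono: "\<And>s. 0 \<le> s \<Longrightarrow> s \<le> t \<Longrightarrow> N s \<omega> \<le> N t \<omega>"
    and pos: "\<And>i. 1 \<le> i \<Longrightarrow> 0 < X i \<omega>"
    and ruin: "ruin_time (risk_process c N X z) \<omega> \<le> ereal t"
  shows "z < (\<Sum>i=1..N t \<omega>. X i \<omega>)"
proof -
  obtain d where d: "0 < d" "\<And>u. t \<le> u \<Longrightarrow> u < t + d \<Longrightarrow> N u \<omega> = N t \<omega>"
    using rc by auto
  have "ruin_time (risk_process c N X z) \<omega> < ereal (t + d)"
    using ruin by (rule order.strict_trans1) (use d in simp)
  then obtain s where s: "0 < s" "risk_process c N X z s \<omega> < 0" "s < t + d"
    unfolding ruin_time_def Inf_less_iff by auto
  have "N s \<omega> \<le> N t \<omega>" using mono[of s] d(2)[of s] s by (cases "s \<le> t") auto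
  then have "(\<Sum>i=1..N s \<omega>. X i \<omega>) \<le> (\<Sum>i=1..N t \<omega>. X i \<omega>)"
    using pos by (intro sum_mono2) (auto intro: less_imp_le)
  moreover have "z + c * s < (\<Sum>i=1..N s \<omega>. X i \<omega>)" using s by (simp add: risk_process_def)
  moreover have "0 < c * s" using c s by simp
  ultimately show ?thesis by linarith
qed

lemma claims_exceed_imp_ruin_time_le:
  assumes "0 < t" "z + c * t < (\<Sum>i=1..N t \<omega>. X i \<omega>)"
  shows "ruin_time (risk_process c N X z) \<omega> \<le> ereal t"
  unfolding ruin_time_def using assms by (intro Inf_lower) (auto simp: risk_process_def)

section \<open>The renewal counting process\<close>

text \<open>
  Since the density is nonnegative, its truncation by \<open>ennreal\<close> is harmless, and integrals with respect to the law
  are Lebesgue integrals weighted by the density.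
\<close>

lemma (in prob_space) interarrival_law:
  assumes pars: "0 < lam" "0 < \<alpha>" "\<alpha> \<le> 1"
    and W: "distributed M lborel W (\<lambda>x. ennreal (interarrival_density lam \<alpha> x))"
  shows "positive_law (distr M borel W)"
    and "\<And>H x. H \<in> borel_measurable borel \<Longrightarrow>
      (\<integral>y. H (x - y) \<partial>distr M borel W) = (\<integral>y. interarrival_density lam \<alpha> y * H (x - y) \<partial>lborel)"
    and "\<And>x. cdf (distr M borel W) x = interarrival_cdf lam \<alpha> x"
    and "\<And>x. 0 < x \<Longrightarrow> 0 < cdf (distr M borel W) x"
proof -
  let ?f = "interarrival_density lam \<alpha>"
  note [measurable] = interarrival_density_measurable[OF pars(2), of lam]
  have [measurable]: "W \<in> borel_measurable M"
    using W by (auto simp: distributed_def)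
  have law: "distr M borel W = density lborel (\<lambda>x. ennreal (?f x))"
    using distributed_distr_eq_density[OF W] by (simp cong: distr_cong)
  interpret W: real_distribution "distr M borel W"
    by (rule real_distribution_distr) simp
  show pl: "positive_law (distr M borel W)"
  proof
    have "0 < x" if "0 < ennreal (?f x)" for x
      using that by (cases "0 < x") (auto simp: interarrival_density_def)
    then have "AE x in lborel. 0 < ennreal (?f x) \<longrightarrow> 0 < x" by blast
    moreover have "(\<lambda>x. ennreal (?f x)) \<in> borel_measurable lborel" by measurable
    ultimately show "AE x in distr M borel W. 0 < x"
      unfolding law by (simp only: AE_density)
  qed
  show int: "(\<integral>y. H (x - y) \<partial>distr M borel W) = (\<integral>y. ?f y * H (x - y) \<partial>lborel)"
    if [measurable]: "H \<in> borel_measurable borel" for H :: "real \<Rightarrow> real" and x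
    unfolding law using interarrival_density_nonneg[OF pars]
    by (subst integral_density) auto
  show cdf: "cdf (distr M borel W) x = interarrival_cdf lam \<alpha> x" for x
  proof -
    have "cdf (distr M borel W) x = (\<integral>y. indicator {0..} (x - y) \<partial>distr M borel W)"
    proof -
      have "(\<lambda>y. indicator {0..} (x - y)) = (indicator {..x} :: real \<Rightarrow> real)"
        by (auto simp: fun_eq_iff indicator_def)
      then show ?thesis by (simp add: cdf_def)
    qed
    also have "\<dots> = (\<integral>y. ?f y * indicator {0..} (x - y) \<partial>lborel)"
      by (rule int) simp
    also have "\<dots> = (\<integral>y. ?f y * rl_kernel 1 (x - y) \<partial>lborel)"
    proof (intro integral_cong_AE)
      show "AE y in lborel. ?f y * indicator {0..} (x - y) = ?f y * rl_kernel 1 (x - y)"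
        using AE_lborel_singleton[of x]
        by eventually_elim (auto simp: rl_kernel_def indicator_def)
    qed auto
    also have "\<dots> = interarrival_cdf lam \<alpha> x"
      using has_integral_interarrival_cdf[OF pars(2)] by (rule has_bochner_integral_integral_eq)
    finally show ?thesis .
  qed
  show "0 < cdf (distr M borel W) x" if "0 < x" for x
  proof (rule ccontr)
    assume "\<not> 0 < cdf (distr M borel W) x"
    then have "measure (distr M borel W) {..x} = 0"
      by (simp add: cdf_def zero_less_measure_iff)
    then have "emeasure (density lborel (\<lambda>x. ennreal (?f x))) {..x} = 0"
      using W.emeasure_eq_measure by (simp add: law[symmetric])
    then have "AE y in lborel. ennreal (?f y) * indicator {..x} y = 0"
      by (simp add: emeasure_density nn_integral_0_iff_AE)
    then have "AE y in lborel. y \<notin> {0<..<x}"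
      by eventually_elim (use interarrival_density_pos[OF pars] in \<open>force simp: indicator_def\<close>)
    then have "emeasure lborel {0<..<x} = 0"
      by (subst (asm) AE_iff_measurable[of "{0<..<x}"]) auto
    then show False using that by simp
  qed
qed

text \<open>
  By uniqueness for the renewal equation.  The solution is bounded on \<open>{..t}\<close> since its kernels have
  index at least \<open>1\<close> and hence increase.
\<close>

lemma (in prob_space) mean_count_sums:
  assumes pars: "0 < lam" "0 < \<alpha>" "\<alpha> \<le> 1"
    and W: "distributed M lborel W (\<lambda>x. ennreal (interarrival_density lam \<alpha> x))"
  shows "(\<lambda>n. conv_cdf (distr M borel W) (Suc n) t) sums mean_count lam \<alpha> t"
proof -
  interpret W: positive_law "distr M borel W" by (rule interarrival_law(1)[OF pars W])
  have [measurable]: "mean_count lam \<alpha> \<in> borel_measurable borel"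
    unfolding mean_count_def by measurable
  show ?thesis
  proof (rule W.renewal_equation_solution)
    show "mean_count lam \<alpha> x = 0" if "x < 0" for x
      using that by (simp add: mean_count_def)
    show "\<bar>mean_count lam \<alpha> x\<bar> \<le> gamma_series \<alpha> (2 * \<alpha> + 1) (\<lambda>i. \<bar>lam\<^sup>2 * (- 2 * lam) ^ i\<bar>) t" if "x \<le> t" for x
      unfolding mean_count_def using pars that by (intro gamma_series_mono) auto
    show "mean_count lam \<alpha> x = cdf (distr M borel W) x + (\<integral>y. mean_count lam \<alpha> (x - y) \<partial>distr M borel W)" for x
      using has_bochner_integral_integral_eq[OF mean_count_renewal[OF pars(2), of lam x]]
      by (simp add: interarrival_law[OF pars W])
  qed simp
qed

text \<open>
  Split the event according to the value of \<open>N t\<close>: each piece is the intersection of an event of the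
  counting process with an event of the claims.
\<close>

lemma (in prob_space) random_sum_tail_prob:
  fixes X :: "nat \<Rightarrow> 'a \<Rightarrow> real" and N :: "real \<Rightarrow> 'a \<Rightarrow> nat"
  assumes X: "\<And>i. 1 \<le> i \<Longrightarrow> X i \<in> borel_measurable M"
    and N: "N t \<in> measurable M (count_space UNIV)"
    and t: "0 \<le> t"
    and indep: "indep_set (process_events M borel {1..} X) (process_events M (count_space UNIV) {0..} N)"
  shows "(\<lambda>n. prob {\<omega> \<in> space M. N t \<omega> = n} * prob {\<omega> \<in> space M. x < (\<Sum>i=1..n. X i \<omega>)}) sums
     prob {\<omega> \<in> space M. x < (\<Sum>i=1..N t \<omega>. X i \<omega>)}"
proof -
  note [measurable] = N
  have [measurable]: "(\<lambda>\<omega>. \<Sum>i=1..n. X i \<omega>) \<in> borel_measurable M" for n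
    using X by (intro borel_measurable_sum) auto
  let ?A = "\<lambda>n. {\<omega> \<in> space M. N t \<omega> = n}" and ?B = "\<lambda>n. {\<omega> \<in> space M. x < (\<Sum>i=1..n. X i \<omega>)}"
  have A: "?A n \<in> process_events M (count_space UNIV) {0..} N" for n
  proof -
    have "?A n = N t -` {n} \<inter> space M" by auto
    then show ?thesis unfolding process_events_def
      by (intro sigma_sets.Basic) (use t in auto)
  qed
  have B: "?B n \<in> process_events M borel {1..} X" for n
  proof -
    let ?gen = "\<Union>i\<in>{1..}. {X i -` A \<inter> space M |A. A \<in> sets borel}"
    define S where "S = sigma (space M) ?gen"
    have gen: "?gen \<subseteq> Pow (space M)" by auto
    have sp: "space S = space M" and se: "sets S = process_events M borel {1..} X"
      using gen by (auto simp: S_def process_events_def)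
    have "X i \<in> borel_measurable S" if "1 \<le> i" for i
    proof (rule measurableI)
      fix A :: "real set" assume "A \<in> sets borel"
      then show "X i -` A \<inter> space S \<in> sets S"
        unfolding sp se process_events_def using that by (intro sigma_sets.Basic) auto
    qed simp
    then have [measurable]: "(\<lambda>\<omega>. \<Sum>i=1..n. X i \<omega>) \<in> borel_measurable S"
      by (intro borel_measurable_sum) auto
    have "{\<omega> \<in> space S. x < (\<Sum>i=1..n. X i \<omega>)} \<in> sets S" by measurable
    then show ?thesis by (simp only: sp se)
  qed
  have eq: "prob (?A n \<inter> ?B n) = prob (?A n) * prob (?B n)" for n
    using indep_setD[OF indep B[of n] A[of n]] by (simp add: Int_commute mult.commute)
  have "?A n \<inter> ?B n \<in> events" for n
    by (intro sets.Int) measurable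
  then have "(\<lambda>n. prob (?A n \<inter> ?B n)) sums prob (\<Union>n. ?A n \<inter> ?B n)"
    by (intro finite_measure_UNION) (auto simp: disjoint_family_on_def)
  moreover have "(\<Union>n. ?A n \<inter> ?B n) = {\<omega> \<in> space M. x < (\<Sum>i=1..N t \<omega>. X i \<omega>)}"
    by auto
  ultimately show ?thesis by (simp only: eq)
qed

locale renewal_count = prob_space M for M :: "'a measure" +
  fixes W :: "nat \<Rightarrow> 'a \<Rightarrow> real" and N :: "real \<Rightarrow> 'a \<Rightarrow> nat" and \<nu> :: "real measure"
  assumes W_indep: "indep_vars (\<lambda>_. borel) W {1..}"
    and W_law: "\<And>i. 1 \<le> i \<Longrightarrow> distr M borel (W i) = \<nu>"
    and W_pos: "\<And>i \<omega>. 1 \<le> i \<Longrightarrow> \<omega> \<in> space M \<Longrightarrow> 0 < W i \<omega>"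
    and N_eq: "\<And>t \<omega>. 0 \<le> t \<Longrightarrow> \<omega> \<in> space M \<Longrightarrow> N t \<omega> = card (renewals_until (\<lambda>i. W i \<omega>) t)"
begin

lemma W_measurable: "1 \<le> i \<Longrightarrow> W i \<in> borel_measurable M"
  using W_indep by (auto simp: indep_vars_def2)

sublocale nu: positive_law \<nu>
proof -
  have "W 1 \<in> borel_measurable M" by (rule W_measurable) simp
  moreover have "AE \<omega> in M. 0 < W 1 \<omega>" using W_pos by (intro AE_I2) auto
  ultimately have "positive_law (distr M borel (W 1))"
    unfolding positive_law_def positive_law_axioms_def
    by (auto intro: real_distribution_distr simp: AE_distr_iff)
  then show "positive_law \<nu>" using W_law[of 1] by simp
qed

lemma epoch_measurable [measurable]: "(\<lambda>\<omega>. renewal_epoch (\<lambda>i. W i \<omega>) n) \<in> borel_measurable M"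
  unfolding renewal_epoch_def by (intro borel_measurable_sum W_measurable) auto

lemma prob_epoch_le: "prob {\<omega> \<in> space M. renewal_epoch (\<lambda>i. W i \<omega>) n \<le> t} = conv_cdf \<nu> n t"
  unfolding renewal_epoch_def by (rule indep_sum_le[OF W_indep W_law])

lemma N_eq_iff:
  assumes "0 \<le> t" "1 \<le> n" "\<omega> \<in> space M"
  shows "N t \<omega> = n \<longleftrightarrow> renewal_epoch (\<lambda>i. W i \<omega>) n \<le> t \<and> t < renewal_epoch (\<lambda>i. W i \<omega>) (Suc n)"
  using assms W_pos by (simp add: N_eq card_renewals_until_iff)

lemma prob_count:
  assumes "0 \<le> t" "1 \<le> n"
  shows "prob {\<omega> \<in> space M. N t \<omega> = n} = conv_cdf \<nu> n t - conv_cdf \<nu> (Suc n) t"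
proof -
  let ?E = "\<lambda>n. {\<omega> \<in> space M. renewal_epoch (\<lambda>i. W i \<omega>) n \<le> t}"
  have "{\<omega> \<in> space M. N t \<omega> = n} = ?E n - ?E (Suc n)"
  proof (rule set_eqI)
    fix \<omega>
    show "\<omega> \<in> {\<omega> \<in> space M. N t \<omega> = n} \<longleftrightarrow> \<omega> \<in> ?E n - ?E (Suc n)"
    proof (cases "\<omega> \<in> space M")
      case True
      with N_eq_iff[OF assms True] show ?thesis by (simp only: mem_Collect_eq Diff_iff simp_thms not_le)
    qed simp
  qed
  moreover have "?E (Suc n) \<subseteq> ?E n"
  proof (rule subsetI)
    fix \<omega> assume \<omega>: "\<omega> \<in> ?E (Suc n)"
    then have "renewal_epoch (\<lambda>i. W i \<omega>) n \<le> renewal_epoch (\<lambda>i. W i \<omega>) (Suc n)"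
      using W_pos by (intro renewal_epoch_mono) auto
    with \<omega> show "\<omega> \<in> ?E n" by auto
  qed
  ultimately show ?thesis
    by (simp add: finite_measure_Diff prob_epoch_le del: conv_cdf.simps)
qed

lemma prob_count_le: "0 \<le> t \<Longrightarrow> prob {\<omega> \<in> space M. N t \<omega> = n} \<le> conv_cdf \<nu> n t"
  by (cases "n = 0") (simp_all add: prob_count del: conv_cdf.simps(2))

lemma prob_count_summable:
  assumes "0 \<le> t" "0 \<le> r"
  shows "summable (\<lambda>n. prob {\<omega> \<in> space M. N t \<omega> = n} * r ^ n)"
  by (rule summable_comparison_test'[OF nu.conv_cdf_weighted_summable[OF assms(2), of t], of 0])
     (use assms prob_count_le in \<open>auto simp: mult.commute[of _ "r ^ _"] intro!: mult_left_mono\<close>)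

text \<open>
  Summation by parts, with a boundary term that vanishes since the epoch probabilities decay
  geometrically.
\<close>

lemma expected_count:
  assumes "0 \<le> t" "(\<lambda>n. conv_cdf \<nu> (Suc n) t) sums m"
  shows "(\<lambda>n. prob {\<omega> \<in> space M. N t \<omega> = n} * real n) sums m"
proof -
  let ?G = "\<lambda>n. conv_cdf \<nu> n t"
  have eq: "(\<Sum>n<k. prob {\<omega> \<in> space M. N t \<omega> = n} * real n) = (\<Sum>n<k. ?G (Suc n)) - real k * ?G k" for k
  proof (induction k)
    case (Suc k)
    have "prob {\<omega> \<in> space M. N t \<omega> = k} * real k = real k * (?G k - ?G (Suc k))"
      using prob_count[OF assms(1), of k] by (cases "k = 0") (auto simp del: conv_cdf.simps)
    with Suc show ?case by (simp add: algebra_simps del: conv_cdf.simps)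
  qed simp
  have "(\<lambda>k. real k * ?G k) \<longlonglongrightarrow> 0"
  proof (rule Lim_null_comparison)
    show "(\<lambda>k. 2 ^ k * ?G k) \<longlonglongrightarrow> 0"
      by (rule summable_LIMSEQ_zero[OF nu.conv_cdf_weighted_summable]) simp
    show "\<forall>\<^sub>F k in sequentially. norm (real k * ?G k) \<le> 2 ^ k * ?G k"
    proof (intro always_eventually allI)
      fix k
      have "real k * ?G k \<le> 2 ^ k * ?G k"
        using real_Suc_le_two_power[of k] by (intro mult_right_mono) auto
      then show "norm (real k * ?G k) \<le> 2 ^ k * ?G k" by (simp add: abs_mult)
    qed
  qed
  then have "(\<lambda>k. (\<Sum>n<k. ?G (Suc n)) - real k * ?G k) \<longlonglongrightarrow> m - 0"
    using assms(2) unfolding sums_def by (intro tendsto_diff)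
  then show ?thesis unfolding sums_def eq by simp
qed

text \<open>
  Infinitely many renewals up to \<open>t\<close> force every epoch to be at most \<open>t\<close>, and the probability of this is
  below all \<open>conv_cdf \<nu> n t\<close>.
\<close>

lemma AE_finite_renewals:
  assumes "0 \<le> t"
  shows "AE \<omega> in M. finite (renewals_until (\<lambda>i. W i \<omega>) t)"
proof -
  let ?B = "{\<omega> \<in> space M. \<forall>n. renewal_epoch (\<lambda>i. W i \<omega>) n \<le> t}"
  have B: "?B \<in> sets M" by measurable
  have "prob ?B \<le> conv_cdf \<nu> n t" for n
    unfolding prob_epoch_le[symmetric] by (intro finite_measure_mono) auto
  then have "prob ?B \<le> 0"
    by (intro LIMSEQ_le_const[OF nu.conv_cdf_tendsto_0]) auto
  then have "prob ?B = 0" using measure_nonneg[of M ?B] by linarith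
  then have "AE \<omega> in M. \<omega> \<notin> ?B"
    using B by (subst AE_iff_measurable[of ?B]) (auto simp: emeasure_eq_measure)
  then show ?thesis
  proof (rule AE_mp, intro AE_I2 impI)
    fix \<omega> assume \<omega>: "\<omega> \<in> space M" "\<omega> \<notin> ?B"
    then obtain n where n: "t < renewal_epoch (\<lambda>i. W i \<omega>) n" by (auto simp: not_le)
    have "m < n" if "m \<in> renewals_until (\<lambda>i. W i \<omega>) t" for m
    proof (rule ccontr)
      assume "\<not> m < n"
      then have "renewal_epoch (\<lambda>i. W i \<omega>) n \<le> renewal_epoch (\<lambda>i. W i \<omega>) m"
        using W_pos \<omega> by (intro renewal_epoch_mono) auto
      with n that show False by (simp add: renewals_until_def)
    qed
    then have "renewals_until (\<lambda>i. W i \<omega>) t \<subseteq> {..<n}" by blast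
    then show "finite (renewals_until (\<lambda>i. W i \<omega>) t)"
      by (rule finite_subset) simp
  qed
qed

lemma N_right_const:
  assumes "\<omega> \<in> space M" "0 \<le> s"
  shows "\<exists>d>0. \<forall>u. s \<le> u \<and> u < s + d \<longrightarrow> N u \<omega> = N s \<omega>"
proof -
  have "\<exists>d>0. \<forall>u. s \<le> u \<and> u < s + d \<longrightarrow>
      card (renewals_until (\<lambda>i. W i \<omega>) u) = card (renewals_until (\<lambda>i. W i \<omega>) s)"
    by (rule card_renewals_until_right_const) (use W_pos assms in auto)
  then obtain d where d: "0 < d" "\<forall>u. s \<le> u \<and> u < s + d \<longrightarrow>
      card (renewals_until (\<lambda>i. W i \<omega>) u) = card (renewals_until (\<lambda>i. W i \<omega>) s)"
    by blast
  have "N u \<omega> = N s \<omega>" if "s \<le> u" "u < s + d" for u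
  proof -
    have "0 \<le> u" using assms that by simp
    then show ?thesis using d(2)[rule_format, of u] that assms by (simp only: N_eq)
  qed
  with d(1) show ?thesis by blast
qed

end

section \<open>The finite-time ruin probability\<close>

theorem proposition4p2:
  fixes M :: "'a measure"
    and N :: "real \<Rightarrow> 'a \<Rightarrow> nat"
    and X :: "nat \<Rightarrow> 'a \<Rightarrow> real"
    and lam \<alpha> c t :: real
  assumes "prob_space M"
    and "0 < lam" and "0 < \<alpha>" and "\<alpha> \<le> 1" and "0 < c"
    and "renewal_counting_process M (interarrival_density lam \<alpha>) N"
    and "prob_space.indep_vars M (\<lambda>_. borel) X {1..}"
    and "\<And>i. 1 \<le> i \<Longrightarrow> distr M borel (X i) = distr M borel (X 1)"
    and "\<And>i. 1 \<le> i \<Longrightarrow> AE \<omega> in M. 0 < X i \<omega>"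
    and "integrable M (X 1)"
    and "integrable M (\<lambda>\<omega>. (X 1 \<omega>)\<^sup>2)"
    and "prob_space.indep_set M
           (process_events M borel {1..} X)
           (process_events M (count_space UNIV) {0..} N)"
    and "subexponential (distr M borel (X 1))"
    and "0 < t"
  shows "((\<lambda>z. ruin_probability M (risk_process c N X z) t /
               (lam\<^sup>2 * t powr (2 * \<alpha>) * mittag_leffler \<alpha> (2 * \<alpha> + 1) (- 2 * lam * t powr \<alpha>) *
                measure M {\<omega> \<in> space M. z < X 1 \<omega>})) \<longlongrightarrow> 1) at_top"
proof -
  interpret prob_space M by fact
  note lam = \<open>0 < lam\<close> and al = \<open>0 < \<alpha>\<close> \<open>\<alpha> \<le> 1\<close> and c = \<open>0 < c\<close> and t = \<open>0 < t\<close>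
  obtain W :: "nat \<Rightarrow> 'a \<Rightarrow> real" where
    W_indep: "indep_vars (\<lambda>_. borel) W {1..}" and
    W_dens: "\<And>i. 1 \<le> i \<Longrightarrow> distributed M lborel (W i) (\<lambda>x. ennreal (interarrival_density lam \<alpha> x))" and
    W_pos: "\<And>i \<omega>. 1 \<le> i \<Longrightarrow> \<omega> \<in> space M \<Longrightarrow> 0 < W i \<omega>" and
    N_card: "\<And>t \<omega>. 0 \<le> t \<Longrightarrow> \<omega> \<in> space M \<Longrightarrow> N t \<omega> = card {n. 1 \<le> n \<and> (\<Sum>i=1..n. W i \<omega>) \<le> t}"
    using assms(6) unfolding renewal_counting_process_def by blast
  define \<nu> where "\<nu> = distr M borel (W 1)"
  have W_law: "distr M borel (W i) = \<nu>" if "1 \<le> i" for i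
    using distributed_distr_eq_density[OF W_dens[OF that]] distributed_distr_eq_density[OF W_dens[of 1]]
    by (simp add: \<nu>_def cong: distr_cong)
  interpret renewal_count M W N \<nu>
    by unfold_locales
       (use W_indep W_law W_pos N_card in \<open>auto simp: renewals_until_def renewal_epoch_def\<close>)
  define m where "m = mean_count lam \<alpha> t"
  have m_sums: "(\<lambda>n. conv_cdf \<nu> (Suc n) t) sums m"
    unfolding m_def \<nu>_def using W_dens[of 1] by (intro mean_count_sums lam al) auto
  have m_pos: "0 < m"
  proof -
    have "0 < cdf \<nu> t"
      unfolding \<nu>_def using W_dens[of 1] by (intro interarrival_law(4)[OF lam al _ t]) auto
    also have "\<dots> = (\<Sum>n<1. conv_cdf \<nu> (Suc n) t)"
      by (simp add: nu.conv_cdf_Suc_0 del: conv_cdf.simps)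
    also have "\<dots> \<le> (\<Sum>n. conv_cdf \<nu> (Suc n) t)"
      using m_sums by (intro sum_le_suminf) (auto simp: sums_iff simp del: conv_cdf.simps)
    also have "\<dots> = m" using m_sums by (simp add: sums_iff)
    finally show ?thesis .
  qed
  define \<mu> where "\<mu> = distr M borel (X 1)"
  have X_meas [measurable]: "X i \<in> borel_measurable M" if "1 \<le> i" for i
    using assms(7) that by (auto simp: indep_vars_def2)
  have "subexponential \<mu>" using assms(13) by (simp add: \<mu>_def)
  then interpret mu: subexponential_law \<mu>
    unfolding subexponential_law_def positive_law_def subexponential_def
      positive_law_axioms_def subexponential_law_axioms_def
    by (auto simp: real_distribution.cdf_convolution_self)
  have tail_prob: "prob {\<omega> \<in> space M. x < X 1 \<omega>} = mu.tail x" for x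
  proof -
    have "prob {\<omega> \<in> space M. x < X 1 \<omega>} = prob (space M - {\<omega> \<in> space M. X 1 \<omega> \<le> x})"
      by (intro arg_cong[where f = prob]) auto
    also have "\<dots> = 1 - prob {\<omega> \<in> space M. X 1 \<omega> \<le> x}" 
      by (rule prob_compl) simp
    also have "prob {\<omega> \<in> space M. X 1 \<omega> \<le> x} = cdf \<mu> x"
      unfolding cdf_def \<mu>_def
      by (subst measure_distr) (auto intro!: arg_cong[where f = prob])
    finally show ?thesis by (simp add: mu.tail_def)
  qed
  have claims_meas [measurable]: "(\<lambda>\<omega>. \<Sum>i=1..n. X i \<omega>) \<in> borel_measurable M" for n
    by (intro borel_measurable_sum) auto
  have sum_tail_prob: "prob {\<omega> \<in> space M. x < (\<Sum>i=1..n. X i \<omega>)} = mu.sum_tail n x" for n x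
  proof -
    have "prob {\<omega> \<in> space M. x < (\<Sum>i=1..n. X i \<omega>)} = prob (space M - {\<omega> \<in> space M. (\<Sum>i=1..n. X i \<omega>) \<le> x})"
      by (intro arg_cong[where f = prob]) auto
    also have "\<dots> = 1 - prob {\<omega> \<in> space M. (\<Sum>i=1..n. X i \<omega>) \<le> x}"
      by (rule prob_compl) measurable
    also have "prob {\<omega> \<in> space M. (\<Sum>i=1..n. X i \<omega>) \<le> x} = conv_cdf \<mu> n x"
      unfolding \<mu>_def by (rule indep_sum_le[OF assms(7,8)])
    finally show ?thesis by (simp add: mu.sum_tail_def)
  qed
  have N_meas [measurable]: "N s \<in> measurable M (count_space UNIV)" if "0 \<le> s" for s
  proof (rule measurableI)
    fix A :: "nat set"
    have "N s -` A \<inter> space M \<in> process_events M (count_space UNIV) {0..} N"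
      unfolding process_events_def using that by (intro sigma_sets.Basic) auto
    then show "N s -` A \<inter> space M \<in> sets M"
      using assms(12) unfolding indep_set_def indep_sets_def by (auto split: bool.splits)
  qed simp
  define p where "p n = prob {\<omega> \<in> space M. N t \<omega> = n}" for n
  define S where "S x = prob {\<omega> \<in> space M. x < (\<Sum>i=1..N t \<omega>. X i \<omega>)}" for x
  have S_eq: "S x = (\<Sum>n. p n * mu.sum_tail n x)" for x
  proof -
    have "(\<lambda>n. p n * mu.sum_tail n x) sums S x"
      unfolding S_def p_def sum_tail_prob[symmetric]
      by (rule random_sum_tail_prob[OF X_meas N_meas _ assms(12)]) (use t in auto)
    then show ?thesis by (simp add: sums_iff)
  qed
  have S_lim: "((\<lambda>x. S x / mu.tail x) \<longlongrightarrow> m) at_top"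
  proof -
    have "(\<Sum>n. p n * real n) = m"
      unfolding p_def using expected_count[OF _ m_sums] t by (simp add: sums_iff)
    then show ?thesis
      unfolding S_eq using mu.random_sum_tail[of p] prob_count_summable[of t] t by (simp add: p_def)
  qed
  define R where "R z = ruin_probability M (risk_process c N X z) t" for z
  have risk_meas: "{\<omega> \<in> space M. risk_process c N X z q \<omega> < 0} \<in> sets M" if "0 \<le> q" for z q
  proof -
    note [measurable] = N_meas[OF that]
    have "(\<lambda>\<omega>. \<Sum>i=1..N q \<omega>. X i \<omega>) \<in> borel_measurable M"
      by (rule measurable_compose_countable[where f = "\<lambda>n \<omega>. \<Sum>i=1..n. X i \<omega>" and g = "N q"])
         (auto intro: claims_meas N_meas that)
    then show ?thesis unfolding risk_process_def by measurable
  qed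
  have ruin_meas: "{\<omega> \<in> space M. ruin_time (risk_process c N X z) \<omega> \<le> ereal t} \<in> sets M" for z
  proof -
    have "{\<omega> \<in> space M. ruin_time (risk_process c N X z) \<omega> \<le> ereal t} =
      {\<omega> \<in> space M. \<forall>k::nat. \<exists>q\<in>{q \<in> \<rat>. 0 < q \<and> q < t + inverse (real (Suc k))}. risk_process c N X z q \<omega> < 0}"
      using ruin_time_le_iff[where N = N, OF c t N_right_const] by (auto 0 4)
    also have "\<dots> \<in> sets M"
    proof (rule sets.sets_Collect_countable_All)
      fix k :: nat
      show "{\<omega> \<in> space M. \<exists>q\<in>{q \<in> \<rat>. 0 < q \<and> q < t + inverse (real (Suc k))}.
          risk_process c N X z q \<omega> < 0} \<in> sets M"
      proof (rule sets.sets_Collect_countable_Ex')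
        show "countable {q \<in> \<rat>. 0 < q \<and> q < t + inverse (real (Suc k))}"
          by (rule countable_subset[OF _ countable_rat]) auto
      qed (auto intro: risk_meas)
    qed
    finally show ?thesis .
  qed
  \<comment> \<open>Only almost surely: the claims may fail to be positive, and the renewals may accumulate, on a null
      set.\<close>
  have upper: "R z \<le> S z" for z
    unfolding R_def ruin_probability_def S_def
  proof (rule finite_measure_mono_AE)
    have "AE \<omega> in M. \<forall>i\<in>{1..}. 0 < X i \<omega>"
      using assms(9) by (intro AE_ball_countable[THEN iffD2]) auto
    then show "AE \<omega> in M. \<omega> \<in> {\<omega> \<in> space M. ruin_time (risk_process c N X z) \<omega> \<le> ereal t} \<longrightarrow>
        \<omega> \<in> {\<omega> \<in> space M. z < (\<Sum>i=1..N t \<omega>. X i \<omega>)}"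
      using AE_finite_renewals[OF less_imp_le[OF t]]
    proof eventually_elim
      case (elim \<omega>)
      show ?case
      proof (intro impI CollectI conjI)
        assume *: "\<omega> \<in> {\<omega> \<in> space M. ruin_time (risk_process c N X z) \<omega> \<le> ereal t}"
        then show sp: "\<omega> \<in> space M" by simp
        show "z < (\<Sum>i=1..N t \<omega>. X i \<omega>)"
        proof (rule ruin_time_le_imp_claims_exceed[where N = N and X = X, OF c t])
          show "\<exists>d>0. \<forall>u. t \<le> u \<and> u < t + d \<longrightarrow> N u \<omega> = N t \<omega>"
            using N_right_const[OF sp, of t] t by simp
          show "N s \<omega> \<le> N t \<omega>" if "0 \<le> s" "s \<le> t" for s
            using that t sp elim(2) by (simp add: N_eq card_mono renewals_until_mono)
        qed (use elim * in auto)
      qed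
    qed
    have "(\<lambda>\<omega>. \<Sum>i=1..N t \<omega>. X i \<omega>) \<in> borel_measurable M"
      by (rule measurable_compose_countable[where f = "\<lambda>n \<omega>. \<Sum>i=1..n. X i \<omega>" and g = "N t"])
         (use t in \<open>auto intro: claims_meas N_meas\<close>)
    then show "{\<omega> \<in> space M. z < (\<Sum>i=1..N t \<omega>. X i \<omega>)} \<in> sets M" by measurable
  qed
  have lower: "S (z + c * t) \<le> R z" for z
    unfolding R_def ruin_probability_def S_def
    by (intro finite_measure_mono ruin_meas) (auto intro: claims_exceed_imp_ruin_time_le[OF t])
  have shift: "filterlim (\<lambda>z. z + c * t) at_top at_top"
    by (intro filterlim_tendsto_add_at_top_iff[THEN iffD2, of "\<lambda>z. c * t" "c * t", simplified add.commute[of "c * t"]] 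
         tendsto_const filterlim_ident)
  \<comment> \<open>Long-tailedness absorbs the premium income \<open>c * t\<close>.\<close>
  have "((\<lambda>z. mu.tail z / mu.tail (z + c * t)) \<longlongrightarrow> 1) at_top"
    using filterlim_compose[OF mu.long_tailed[of "c * t"] shift] c t by simp
  then have "((\<lambda>z. S (z + c * t) / mu.tail (z + c * t) * inverse (mu.tail z / mu.tail (z + c * t))) \<longlongrightarrow> m * inverse 1) at_top"
    by (intro tendsto_mult tendsto_inverse filterlim_compose[OF S_lim shift]) auto
  moreover have "S (z + c * t) / mu.tail (z + c * t) * inverse (mu.tail z / mu.tail (z + c * t)) = S (z + c * t) / mu.tail z" for z
    using mu.tail_pos[of "z + c * t"] by simp
  ultimately have lower_lim: "((\<lambda>z. S (z + c * t) / mu.tail z) \<longlongrightarrow> m) at_top"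
    by (simp only: inverse_1 mult_1_right)
  have "((\<lambda>z. R z / mu.tail z) \<longlongrightarrow> m) at_top"
    by (rule tendsto_sandwich[OF _ _ lower_lim S_lim])
       (auto intro!: always_eventually divide_right_mono lower upper)
  then have "((\<lambda>z. R z / mu.tail z / m) \<longlongrightarrow> m / m) at_top"
    using m_pos by (intro tendsto_divide tendsto_const) auto
  moreover have "R z / mu.tail z / m = R z / (m * mu.tail z)" for z
    by (simp add: mult.commute)
  moreover have "m / m = 1" using m_pos by simp
  ultimately have "((\<lambda>z. R z / (m * mu.tail z)) \<longlongrightarrow> 1) at_top"
    by (simp only:)
  then show ?thesis
    unfolding mittag_leffler_eq_gamma_series[OF t al(1)] tail_prob
    by (simp add: R_def m_def mean_count_def)
qed

end
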